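(* Let $k\ge 1$. The Sibuya moduli space $\mathcal{M}_{2k}^{\text{Sibuya}}$ is algebraically isomorphic to the Poisson wild character variety $\mathcal{M}_{\mathrm{B}}$, and the multi-ratio function cuts out the symplectic leaves: for every $q\in\mathbb{C}^*$, the subvariety $\mathcal{M}_{2k}^{\text{Sibuya}}(q)$ is algebraically isomorphic to the wild character variety $\mathcal{M}_{\mathrm{B}}(t)$, where $t=\mathrm{diag}(q^{-1},q)$.
   Context: Sibuya spaces: let $X_{2k}^{\text{Sibuya}}=\{(p_1,\ldots,p_{2k})\in\mathbb{P}^1(\mathbb{C})^{2k} : p_1\neq p_2\neq\cdots\neq p_{2k}\neq p_1\}$ (only cyclically consecutive points are required to be distinct), and let $\mathcal{M}_{2k}^{\text{Sibuya}}=X_{2k}^{\text{Sibuya}}/\mathrm{PSL}_2(\mathbb{C})$ be the geometric invariant theory quotient by the diagonal action. The $\mathrm{PSL}_2(\mathbb{C})$-invariant function $\varphi:X_{2k}^{\text{Sibuya}}\to\mathbb{C}^*$ (the multi-ratio up to sign) is $$\varphi(p_1,\ldots,p_{2k})=(-1)^k\frac{(p_1-p_2)(p_3-p_4)\cdots(p_{2k-1}-p_{2k})}{(p_2-p_3)(p_4-p_5)\cdots(p_{2k}-p_1)},$$ interpreted when some $p_i=\infty$ by replacing $p_i-p_j$ by $\det(v_i\,v_j)$ for nonzero vectors $v_i\in\mathbb{C}^2$ spanning the line $p_i$. For $q\in\mathbb{C}^*$ put $\mathcal{M}_{2k}^{\text{Sibuya}}(q)=\varphi^{-1}(q)/\mathrm{PSL}_2(\mathbb{C})\subset\mathcal{M}_{2k}^{\text{Sibuya}}$.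 Wild character varieties: let $U_+$ (resp. $U_-$) be the group of upper (resp. lower) triangular unipotent matrices in $\mathrm{GL}_2(\mathbb{C})$ and $T$ the diagonal subgroup. Write $\mathbf{S}=(S_1,\ldots,S_{2k})\in(U_+\times U_-)^k$ with $S_{\text{odd}}\in U_+$, $S_{\text{even}}\in U_-$. Then $$\mathcal{M}_{\mathrm{B}}=\{\mathbf{S}\in(U_+\times U_-)^k : S_{2k}\cdots S_2S_1\in T\}/T,$$ where $T$ acts by diagonal conjugation and the quotient is the affine geometric invariant theory quotient (the affine variety associated to the ring of $T$-invariant functions). For $t\in T$ of determinant one, $$\mathcal{M}_{\mathrm{B}}(t)=\{\mathbf{S}\in(U_+\times U_-)^k : S_{2k}\cdots S_2S_1=t\}/T\subset\mathcal{M}_{\mathrm{B}}.$$ $\mathcal{M}_{\mathrm{B}}$ is a Poisson variety (as the quotient by $T$ of a quasi-Hamiltonian $T$-space with moment map $S_{2k}\cdots S_2S_1$) and its symplectic leaves are the subvarieties $\mathcal{M}_{\mathrm{B}}(t)$. *)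

theory Defs
  imports "HOL-Analysis.Analysis"
begin

text \<open>
  A variety is represented by its set of closed points together with its complex-valued
  regular functions. Functions on a set are taken to be \<^const>\<open>extensional\<close>, so that equality of
  functions means equality on that set; on the empty set, 0 and 1 coincide.
\<close>

record 'p variety =
  points :: "'p set"
  regular :: "('p \<Rightarrow> complex) set"

inductive_set polynomials_in :: "('x \<Rightarrow> complex) set \<Rightarrow> ('x \<Rightarrow> complex) set"
  for B :: "('x \<Rightarrow> complex) set" where
  const: "(\<lambda>_. c) \<in> polynomials_in B"
| gen: "b \<in> B \<Longrightarrow> b \<in> polynomials_in B"
| add: "f \<in> polynomials_in B \<Longrightarrow> g \<in> polynomials_in B \<Longrightarrow> (\<lambda>x. f x + g x) \<in> polynomials_in B"
| mult: "f \<in> polynomials_in B \<Longrightarrow> g \<in> polynomials_in B \<Longrightarrow> (\<lambda>x. f x * g x) \<in> polynomials_in B"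

definition variety_iso ::
  "('p, 'r) variety_scheme \<Rightarrow> ('q, 's) variety_scheme \<Rightarrow> ('p \<Rightarrow> 'q) \<Rightarrow> bool" where
  "variety_iso V W h \<longleftrightarrow>
     bij_betw h (points V) (points W) \<and>
     (\<forall>g \<in> extensional (points W).
        g \<in> regular W \<longleftrightarrow> (\<lambda>x\<in>points V. g (h x)) \<in> regular V)"

text \<open>
  The affine variety associated with an algebra \<open>A\<close> of functions on a set \<open>X\<close>: its points are the
  unital complex algebra homomorphisms from \<open>A\<close> to the complex numbers, and its regular functions
  are the evaluations at the elements of \<open>A\<close>.
\<close>

definition characters ::
  "'x set \<Rightarrow> ('x \<Rightarrow> complex) set \<Rightarrow> (('x \<Rightarrow> complex) \<Rightarrow> complex) set" where
  "characters X A = {\<xi> \<in> extensional A.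
     (\<forall>c. \<xi> (\<lambda>x\<in>X. c) = c) \<and>
     (\<forall>f\<in>A. \<forall>g\<in>A. \<xi> (\<lambda>x\<in>X. f x + g x) = \<xi> f + \<xi> g \<and>
                    \<xi> (\<lambda>x\<in>X. f x * g x) = \<xi> f * \<xi> g)}"

definition affine_variety_of ::
  "'x set \<Rightarrow> ('x \<Rightarrow> complex) set \<Rightarrow> (('x \<Rightarrow> complex) \<Rightarrow> complex) variety" where
  "affine_variety_of X A =
     \<lparr>points = characters X A, regular = {(\<lambda>\<xi>\<in>characters X A. \<xi> f) | f. f \<in> A}\<rparr>"

text \<open>A group action is given by the set \<open>G\<close> of the transformations by which the group acts.\<close>

definition invariants :: "('p \<Rightarrow> 'p) set \<Rightarrow> 'p variety \<Rightarrow> ('p \<Rightarrow> complex) set" where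
  "invariants G V = {f \<in> regular V. \<forall>g\<in>G. \<forall>x\<in>points V. f (g x) = f x}"

definition git_quotient ::
  "('p \<Rightarrow> 'p) set \<Rightarrow> 'p variety \<Rightarrow> (('p \<Rightarrow> complex) \<Rightarrow> complex) variety" where
  "git_quotient G V = affine_variety_of (points V) (invariants G V)"

text \<open>
  For an invariant subvariety \<open>W\<close> of \<open>V\<close>, the map from the quotient of \<open>W\<close> to the quotient of \<open>V\<close>
  induced by the inclusion, that is, dual to restriction of invariant functions from \<open>V\<close> to \<open>W\<close>.
\<close>

definition git_inclusion ::
  "('p \<Rightarrow> 'p) set \<Rightarrow> 'p variety \<Rightarrow> 'p variety \<Rightarrow>
   (('p \<Rightarrow> complex) \<Rightarrow> complex) \<Rightarrow> (('p \<Rightarrow> complex) \<Rightarrow> complex)" where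
  "git_inclusion G W V \<xi> = (\<lambda>f\<in>invariants G V. \<xi> (restrict f (points W)))"


section \<open>Sibuya spaces\<close>

definition proj_line :: "(complex^2) set set" where
  "proj_line = {vec.span {v} | v. v \<noteq> 0}"

text \<open>A choice of nonzero vectors \<open>v 1, \<dots>, v n\<close> spanning the lines \<open>p 1, \<dots>, p n\<close>.\<close>

definition spans :: "nat \<Rightarrow> (nat \<Rightarrow> complex^2) \<Rightarrow> (nat \<Rightarrow> (complex^2) set) \<Rightarrow> bool" where
  "spans n v p \<longleftrightarrow> (\<forall>i\<in>{1..n}. v i \<noteq> 0 \<and> p i = vec.span {v i})"

definition multi_forms :: "nat \<Rightarrow> (nat \<Rightarrow> nat) \<Rightarrow> ((nat \<Rightarrow> complex^2) \<Rightarrow> complex) set" where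
  "multi_forms n d = {F \<in> polynomials_in {(\<lambda>v. v i $ j) | i j. i \<in> {1..n}}.
     \<forall>c v. F (\<lambda>i. c i *s v i) = (\<Prod>i=1..n. c i ^ d i) * F v}"

text \<open>
  Regular functions on a locally closed subset \<open>Y\<close> of a power of the projective line: those which
  near each point of \<open>Y\<close> are quotients of two forms of equal multidegree.
\<close>

definition regular_functions ::
  "nat \<Rightarrow> (nat \<Rightarrow> (complex^2) set) set \<Rightarrow> ((nat \<Rightarrow> (complex^2) set) \<Rightarrow> complex) set" where
  "regular_functions n Y = {f \<in> extensional Y.
     \<forall>p\<in>Y. \<exists>d. \<exists>F\<in>multi_forms n d. \<exists>G\<in>multi_forms n d.
       (\<exists>v. spans n v p \<and> G v \<noteq> 0) \<and>
       (\<forall>p'\<in>Y. \<forall>v. spans n v p' \<longrightarrow> G v \<noteq> 0 \<longrightarrow> f p' = F v / G v)}"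

definition cyclic_next :: "nat \<Rightarrow> nat \<Rightarrow> nat" where
  "cyclic_next n i = i mod n + 1"

definition sibuya_space :: "nat \<Rightarrow> (nat \<Rightarrow> (complex^2) set) set" where
  "sibuya_space k = {p \<in> {1..2*k} \<rightarrow>\<^sub>E proj_line.
     \<forall>i\<in>{1..2*k}. p i \<noteq> p (cyclic_next (2*k) i)}"

text \<open>The transformations \<open>p \<mapsto> (A p\<^sub>1, \<dots>, A p\<^sub>n)\<close>, on which \<open>A\<close> and \<open>-A\<close> agree.\<close>

definition psl2_action :: "nat \<Rightarrow> ((nat \<Rightarrow> (complex^2) set) \<Rightarrow> (nat \<Rightarrow> (complex^2) set)) set" where
  "psl2_action n = {(\<lambda>p. \<lambda>i\<in>{1..n}. (\<lambda>x. A *v x) ` p i) | A :: complex^2^2. det A = 1}"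

definition vec_det :: "complex^2 \<Rightarrow> complex^2 \<Rightarrow> complex" where
  "vec_det v w = det (transpose (vector [v, w] :: complex^2^2))"

definition vec_multi_ratio :: "nat \<Rightarrow> (nat \<Rightarrow> complex^2) \<Rightarrow> complex" where
  "vec_multi_ratio k v =
     (- 1) ^ k * (\<Prod>i=1..k. vec_det (v (2*i - 1)) (v (2*i))) /
     (\<Prod>i=1..k. vec_det (v (2*i)) (v (cyclic_next (2*k) (2*i))))"

definition multi_ratio :: "nat \<Rightarrow> (nat \<Rightarrow> (complex^2) set) \<Rightarrow> complex" where
  "multi_ratio k p = vec_multi_ratio k (SOME v. spans (2*k) v p)"

lemma vec_det_eq: "vec_det v w = v $ 1 * w $ 2 - v $ 2 * w $ 1"
  unfolding vec_det_def det_transpose by (simp add: det_2)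

lemma vec_det_affine: "vec_det (vector [a, 1]) (vector [b, 1]) = a - b"
  by (simp add: vec_det_eq vector_2)

lemma vec_multi_ratio_scale:
  assumes "\<And>i. i \<in> {1..2*k} \<Longrightarrow> c i \<noteq> 0 \<and> w i = c i *s v i"
  shows "vec_multi_ratio k w = vec_multi_ratio k v"
proof (cases "k = 0")
  case True
  then show ?thesis by (simp add: vec_multi_ratio_def)
next
  case False
  let ?n = "cyclic_next (2*k)"
  have det: "vec_det (a *s x) (b *s y) = a * b * vec_det x y" for a b x y
    by (simp add: vec_det_eq algebra_simps)
  have n: "?n (2*i) \<in> {1..2*k}" if "i \<in> {1..k}" for i
    using False by (auto simp: cyclic_next_def Suc_le_eq)
  have 1: "(\<Prod>i=1..k. vec_det (w (2*i - 1)) (w (2*i))) =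
      (\<Prod>i=1..k. c (2*i - 1) * c (2*i)) * (\<Prod>i=1..k. vec_det (v (2*i - 1)) (v (2*i)))"
    unfolding prod.distrib[symmetric]
  proof (rule prod.cong)
    fix i assume "i \<in> {1..k}"
    then have "2*i - 1 \<in> {1..2*k}" "2*i \<in> {1..2*k}" by auto
    then show "vec_det (w (2*i - 1)) (w (2*i)) =
        c (2*i - 1) * c (2*i) * vec_det (v (2*i - 1)) (v (2*i))"
      using assms det by metis
  qed simp
  have 2: "(\<Prod>i=1..k. vec_det (w (2*i)) (w (?n (2*i)))) =
      (\<Prod>i=1..k. c (2*i) * c (?n (2*i))) * (\<Prod>i=1..k. vec_det (v (2*i)) (v (?n (2*i))))"
    unfolding prod.distrib[symmetric] by (rule prod.cong) (use n in \<open>auto simp: assms det\<close>)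
  have 3: "(\<Prod>i=1..k. c (?n (2*i))) = (\<Prod>i=1..k. c (2*i - 1))"
  proof -
    obtain m where m: "k = Suc m" using False not0_implies_Suc by blast
    have "(\<Prod>i=1..k. c (?n (2*i))) = (\<Prod>i=1..m. c (2*i + 1)) * c 1"
      unfolding m by (simp add: cyclic_next_def)
    also have "\<dots> = c 1 * (\<Prod>i=Suc 1..Suc m. c (2*i - 1))"
      unfolding prod.shift_bounds_cl_Suc_ivl by simp
    also have "\<dots> = (\<Prod>i=1..k. c (2*i - 1))"
      unfolding m by (subst (2) prod.atLeast_Suc_atMost) simp_all
    finally show ?thesis .
  qed
  have "c (2*i - 1) * c (2*i) \<noteq> 0" if "i \<in> {1..k}" for i
  proof -
    from that have "2*i - 1 \<in> {1..2*k}" "2*i \<in> {1..2*k}" by auto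
    then show ?thesis using assms by simp
  qed
  then have "(\<Prod>i=1..k. c (2*i - 1) * c (2*i)) \<noteq> 0"
    by (meson finite_atLeastAtMost prod_zero_iff)
  then show ?thesis
    unfolding vec_multi_ratio_def 1 2 using 3 by (simp add: prod.distrib mult.commute)
qed

lemma multi_ratio_eq:
  assumes "spans (2*k) v p"
  shows "multi_ratio k p = vec_multi_ratio k v"
proof -
  define w where "w = (SOME v. spans (2*k) v p)"
  have w: "spans (2*k) w p"
    unfolding w_def using someI[of "\<lambda>v. spans (2*k) v p", OF assms] .
  have "\<exists>c. c \<noteq> 0 \<and> w i = c *s v i" if "i \<in> {1..2*k}" for i
  proof -
    have "w i \<in> vec.span {v i}" "w i \<noteq> 0"
      using w assms that vec.span_base[of "w i" "{w i}"] by (auto simp: spans_def)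
    then show ?thesis by (auto simp: vec.span_singleton)
  qed
  then obtain c where "\<And>i. i \<in> {1..2*k} \<Longrightarrow> c i \<noteq> 0 \<and> w i = c i *s v i"
    by metis
  then show ?thesis
    unfolding multi_ratio_def w_def[symmetric] by (rule vec_multi_ratio_scale)
qed

definition sibuya_variety :: "nat \<Rightarrow> (nat \<Rightarrow> (complex^2) set) variety" where
  "sibuya_variety k =
     \<lparr>points = sibuya_space k, regular = regular_functions (2*k) (sibuya_space k)\<rparr>"

definition sibuya_level :: "nat \<Rightarrow> complex \<Rightarrow> (nat \<Rightarrow> (complex^2) set) variety" where
  "sibuya_level k q =
     (let Y = {p \<in> sibuya_space k. multi_ratio k p = q}
      in \<lparr>points = Y, regular = regular_functions (2*k) Y\<rparr>)"

text \<open>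
  The Sibuya space is affine, being the complement in a power of the projective line of an ample
  divisor, so its geometric invariant theory quotient is the affine one.
\<close>

definition sibuya_moduli ::
  "nat \<Rightarrow> (((nat \<Rightarrow> (complex^2) set) \<Rightarrow> complex) \<Rightarrow> complex) variety" where
  "sibuya_moduli k = git_quotient (psl2_action (2*k)) (sibuya_variety k)"

definition sibuya_moduli_level ::
  "nat \<Rightarrow> complex \<Rightarrow> (((nat \<Rightarrow> (complex^2) set) \<Rightarrow> complex) \<Rightarrow> complex) variety" where
  "sibuya_moduli_level k q = git_quotient (psl2_action (2*k)) (sibuya_level k q)"

definition sibuya_inclusion ::
  "nat \<Rightarrow> complex \<Rightarrow>
   (((nat \<Rightarrow> (complex^2) set) \<Rightarrow> complex) \<Rightarrow> complex) \<Rightarrow>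
   (((nat \<Rightarrow> (complex^2) set) \<Rightarrow> complex) \<Rightarrow> complex)" where
  "sibuya_inclusion k q =
     git_inclusion (psl2_action (2*k)) (sibuya_level k q) (sibuya_variety k)"

text \<open>The function on the quotient induced by the invariant function \<^const>\<open>multi_ratio\<close>.\<close>

definition moduli_multi_ratio ::
  "nat \<Rightarrow> (((nat \<Rightarrow> (complex^2) set) \<Rightarrow> complex) \<Rightarrow> complex) \<Rightarrow> complex" where
  "moduli_multi_ratio k x = x (restrict (multi_ratio k) (sibuya_space k))"


section \<open>Wild character varieties\<close>

definition upper_unipotent :: "(complex^2^2) set" where
  "upper_unipotent = {A. A $ 1 $ 1 = 1 \<and> A $ 2 $ 2 = 1 \<and> A $ 2 $ 1 = 0}"

definition lower_unipotent :: "(complex^2^2) set" where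
  "lower_unipotent = {A. A $ 1 $ 1 = 1 \<and> A $ 2 $ 2 = 1 \<and> A $ 1 $ 2 = 0}"

definition torus :: "(complex^2^2) set" where
  "torus = {A. invertible A \<and> A $ 1 $ 2 = 0 \<and> A $ 2 $ 1 = 0}"

definition stokes_data :: "nat \<Rightarrow> (nat \<Rightarrow> complex^2^2) set" where
  "stokes_data k =
     (\<Pi>\<^sub>E i\<in>{1..2*k}. if odd i then upper_unipotent else lower_unipotent)"

text \<open>The product \<open>S n ** \<dots> ** S 2 ** S 1\<close>.\<close>

primrec stokes_product :: "(nat \<Rightarrow> complex^2^2) \<Rightarrow> nat \<Rightarrow> complex^2^2" where
  "stokes_product S 0 = mat 1"
| "stokes_product S (Suc n) = S (Suc n) ** stokes_product S n"

definition torus_action :: "nat \<Rightarrow> ((nat \<Rightarrow> complex^2^2) \<Rightarrow> (nat \<Rightarrow> complex^2^2)) set" where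
  "torus_action n = {(\<lambda>S. \<lambda>i\<in>{1..n}. h ** S i ** matrix_inv h) | h. h \<in> torus}"

text \<open>
  A Zariski closed set of tuples of matrices, as an affine variety. The condition that the product
  of a tuple in \<^const>\<open>stokes_data\<close> lies in \<^const>\<open>torus\<close> is closed, since its determinant is 1.
\<close>

definition matrix_variety :: "nat \<Rightarrow> (nat \<Rightarrow> complex^2^2) set \<Rightarrow> (nat \<Rightarrow> complex^2^2) variety" where
  "matrix_variety n Y =
     \<lparr>points = Y,
      regular = {restrict f Y | f.
        f \<in> polynomials_in {(\<lambda>S. S i $ a $ b) | i a b. i \<in> {1..n}}}\<rparr>"

definition wild_variety :: "nat \<Rightarrow> (nat \<Rightarrow> complex^2^2) variety" where
  "wild_variety k = matrix_variety (2*k) {S \<in> stokes_data k. stokes_product S (2*k) \<in> torus}"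

definition wild_fibre :: "nat \<Rightarrow> complex^2^2 \<Rightarrow> (nat \<Rightarrow> complex^2^2) variety" where
  "wild_fibre k t = matrix_variety (2*k) {S \<in> stokes_data k. stokes_product S (2*k) = t}"

definition wild_char_variety ::
  "nat \<Rightarrow> (((nat \<Rightarrow> complex^2^2) \<Rightarrow> complex) \<Rightarrow> complex) variety" where
  "wild_char_variety k = git_quotient (torus_action (2*k)) (wild_variety k)"

definition wild_char_leaf ::
  "nat \<Rightarrow> complex^2^2 \<Rightarrow> (((nat \<Rightarrow> complex^2^2) \<Rightarrow> complex) \<Rightarrow> complex) variety" where
  "wild_char_leaf k t = git_quotient (torus_action (2*k)) (wild_fibre k t)"

definition wild_inclusion ::
  "nat \<Rightarrow> complex^2^2 \<Rightarrow>
   (((nat \<Rightarrow> complex^2^2) \<Rightarrow> complex) \<Rightarrow> complex) \<Rightarrow>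
   (((nat \<Rightarrow> complex^2^2) \<Rightarrow> complex) \<Rightarrow> complex)" where
  "wild_inclusion k t = git_inclusion (torus_action (2*k)) (wild_fibre k t) (wild_variety k)"

definition diag2 :: "complex \<Rightarrow> complex \<Rightarrow> complex^2^2" where
  "diag2 a b = vector [vector [a, 0], vector [0, b]]"

end

theory Submission
  imports Defs "HOL-Computational_Algebra.Fundamental_Theorem_Algebra"
begin

text \<open>
  A point \<open>p\<close> of the Sibuya space can be lifted to vectors \<open>u 0, \<dots>, u (2*k + 1)\<close> spanning the lines
  \<open>p (2*k), p 1, \<dots>, p (2*k), p 1\<close> such that consecutive vectors have determinant \<open>-1\<close> and \<open>1\<close> alternately.
  Then \<open>u (i + 1) = u (i - 1) - a i *s u i\<close> for some numbers \<open>a i\<close>, and these are taken as the off-diagonal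
  entries of unipotent matrices \<open>S i\<close>. The recursion says that the partial products of the \<open>S i\<close>, inverted,
  have the vectors of the frame as columns with respect to the basis \<open>u 1, u 0\<close>. So the total product is
  diagonal because the last two vectors return to the lines of the first two, and its lower right entry
  is the multi-ratio, because all determinants in the multi-ratio are \<open>1\<close> or \<open>-1\<close> except the one that
  closes the cycle (\<open>normalized_frame_stokes_of\<close>). Conversely, Stokes data \<open>S\<close> give lines spanned by the vectors
  of the recursion that starts with the standard basis (\<open>normalized_frame_stokes_lines\<close>). A frame of \<open>p\<close> is
  unique up to a factor \<open>\<mu>\<close> at the even and its inverse at the odd indices, and this changes \<open>S\<close> by the
  torus; a matrix of determinant 1 moves the frame of \<open>p\<close> without changing \<open>S\<close>. So the two constructions are
  mutually inverse up to the group actions.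

  They carry regular invariants to regular invariants. For an invariant of the Stokes data this is a
  computation of multidegrees, once the scale of the frame is fixed near a given point
  (\<open>regular_of_stokes_invariant\<close>). A regular function on the Sibuya space is only locally a quotient of
  forms, so its pullback to the Stokes data is only locally a quotient of polynomials, and
  Hilbert's Nullstellensatz makes it a polynomial (\<open>regular_pullback_polynomial\<close>). Over the complex numbers
  the Nullstellensatz follows from the algebra having countable dimension (\<open>residue_value_exists\<close>).
  Both statements hold for the whole space and for the levels of the multi-ratio alike, which gives
  compatible isomorphisms of the quotients.

  It remains to see that the level of the multi-ratio in the quotient is the image of the quotient of the
  level. On the side of the Stokes data, each point of the quotient is represented by actual Stokes data,
  since the torus is reductive (\<open>character_is_evaluation\<close>), and these data lie in the level.
\<close>

section \<open>Polynomial functions and their ideals\<close>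

text \<open>
  Gaussian elimination of one equation at a time: an equation with a nonzero coefficient at some
  unknown \<open>d\<close> is solved for that unknown.
\<close>

lemma underdetermined_system_solvable:
  fixes \<alpha> :: "'c \<Rightarrow> 'j \<Rightarrow> 'a::field"
  assumes "finite J" "finite C" "card J < card C"
  shows "\<exists>u. (\<exists>c\<in>C. u c \<noteq> 0) \<and> (\<forall>j\<in>J. (\<Sum>c\<in>C. u c * \<alpha> c j) = 0)"
  using assms
proof (induction J arbitrary: C \<alpha> rule: finite_induct)
  case empty
  then obtain c where "c \<in> C" by fastforce
  then show ?case by (intro exI[of _ "\<lambda>_. 1"]) auto
next
  case (insert j J)
  show ?case
  proof (cases "\<forall>c\<in>C. \<alpha> c j = 0")
    case True
    obtain u where u: "\<exists>c\<in>C. u c \<noteq> 0" "\<forall>i\<in>J. (\<Sum>c\<in>C. u c * \<alpha> c i) = 0"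
      using insert.IH[of C \<alpha>] insert.prems insert.hyps by auto
    with True show ?thesis by (intro exI[of _ u]) auto
  next
    case False
    then obtain d where d: "d \<in> C" "\<alpha> d j \<noteq> 0" by blast
    define C' where "C' = C - {d}"
    define \<beta> where "\<beta> c i = \<alpha> c i - \<alpha> c j / \<alpha> d j * \<alpha> d i" for c i
    have C: "C = insert d C'" "d \<notin> C'" "finite C'" using d insert.prems by (auto simp: C'_def)
    have "card J < card C'" using C insert.prems insert.hyps by auto
    then obtain u where u: "\<exists>c\<in>C'. u c \<noteq> 0" "\<forall>i\<in>J. (\<Sum>c\<in>C'. u c * \<beta> c i) = 0"
      using insert.IH[of C' \<beta>] C by auto
    define w where "w = u(d := - (\<Sum>c\<in>C'. u c * \<alpha> c j) / \<alpha> d j)"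
    have sum: "(\<Sum>c\<in>C. w c * \<alpha> c i) = (\<Sum>c\<in>C'. u c * \<beta> c i)" for i
    proof -
      have "(\<Sum>c\<in>C. w c * \<alpha> c i) = w d * \<alpha> d i + (\<Sum>c\<in>C'. w c * \<alpha> c i)"
        using C by simp
      also have "(\<Sum>c\<in>C'. w c * \<alpha> c i) = (\<Sum>c\<in>C'. u c * \<alpha> c i)"
        using C by (intro sum.cong) (auto simp: w_def)
      also have "w d * \<alpha> d i = - (\<Sum>c\<in>C'. u c * (\<alpha> c j / \<alpha> d j * \<alpha> d i))"
        by (simp add: w_def sum_distrib_right sum_divide_distrib mult.assoc)
      finally show ?thesis by (simp add: \<beta>_def right_diff_distrib sum_subtractf)
    qed
    have "(\<Sum>c\<in>C. w c * \<alpha> c j) = 0" unfolding sum using d by (simp add: \<beta>_def)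
    moreover have "\<exists>c\<in>C. w c \<noteq> 0" using u(1) C by (auto simp: w_def)
    ultimately show ?thesis using u(2) sum by (intro exI[of _ w]) auto
  qed
qed

lemma polynomials_in_uminus: "f \<in> polynomials_in B \<Longrightarrow> (\<lambda>x. - f x) \<in> polynomials_in B"
  using polynomials_in.mult[OF polynomials_in.const[of "-1"]] by simp

lemma polynomials_in_diff:
  "f \<in> polynomials_in B \<Longrightarrow> g \<in> polynomials_in B \<Longrightarrow> (\<lambda>x. f x - g x) \<in> polynomials_in B"
  using polynomials_in.add[OF _ polynomials_in_uminus] by simp

lemma polynomials_in_sum:
  "(\<And>i. i \<in> I \<Longrightarrow> f i \<in> polynomials_in B) \<Longrightarrow> (\<lambda>x. \<Sum>i\<in>I. f i x) \<in> polynomials_in B"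
  by (induction I rule: infinite_finite_induct)
    (auto intro: polynomials_in.add polynomials_in.const)

lemma polynomials_in_prod:
  "(\<And>i. i \<in> I \<Longrightarrow> f i \<in> polynomials_in B) \<Longrightarrow> (\<lambda>x. \<Prod>i\<in>I. f i x) \<in> polynomials_in B"
  by (induction I rule: infinite_finite_induct)
    (auto intro: polynomials_in.mult polynomials_in.const)

lemma polynomials_in_poly:
  "f \<in> polynomials_in B \<Longrightarrow> (\<lambda>x. poly q (f x)) \<in> polynomials_in B"
  by (induction q) (auto intro!: polynomials_in.add polynomials_in.mult polynomials_in.const)

lemma polynomials_in_comp:
  assumes "f \<in> polynomials_in B" "\<And>b. b \<in> B \<Longrightarrow> (\<lambda>x. b (h x)) \<in> polynomials_in C"
  shows "(\<lambda>x. f (h x)) \<in> polynomials_in C"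
  using assms(1) by induction (auto intro: polynomials_in.intros assms(2))

lemma polynomials_in_cong:
  assumes "f \<in> polynomials_in B" "\<And>b. b \<in> B \<Longrightarrow> b x = b y"
  shows "f x = f y"
  using assms(1) by induction (auto intro: assms(2))

text \<open>
  A polynomial function is a finite combination of products of lists of generators. With countably
  many generators there are only countably many such lists; this is the form in which the algebra is
  seen to have countable dimension.
\<close>

lemma polynomials_in_monomial_expansion:
  fixes B :: "('x \<Rightarrow> complex) set"
  assumes "f \<in> polynomials_in B"
  shows "\<exists>T \<alpha>. finite T \<and> T \<subseteq> lists B \<and>
    (\<forall>s. f s = (\<Sum>xs\<in>T. \<alpha> xs * prod_list (map (\<lambda>x. x s) xs)))"
proof -
  let ?m = "\<lambda>(xs :: ('x \<Rightarrow> complex) list) s. prod_list (map (\<lambda>x. x s) xs) :: complex"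
  have "\<exists>L. snd ` set L \<subseteq> lists B \<and> (\<forall>s. f s = (\<Sum>(c, xs)\<leftarrow>L. c * ?m xs s))"
    using assms
  proof induction
    case (const c)
    show ?case by (intro exI[of _ "[(c, [])]"]) auto
  next
    case (gen b)
    then show ?case by (intro exI[of _ "[(1, [b])]"]) auto
  next
    case (add f g)
    then obtain K L where "snd ` set K \<subseteq> lists B" "\<forall>s. f s = (\<Sum>(c, xs)\<leftarrow>K. c * ?m xs s)"
      "snd ` set L \<subseteq> lists B" "\<forall>s. g s = (\<Sum>(c, xs)\<leftarrow>L. c * ?m xs s)" by blast
    then show ?case by (intro exI[of _ "K @ L"]) auto
  next
    case (mult f g)
    then obtain K L where KL: "snd ` set K \<subseteq> lists B" "\<forall>s. f s = (\<Sum>(c, xs)\<leftarrow>K. c * ?m xs s)"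
      "snd ` set L \<subseteq> lists B" "\<forall>s. g s = (\<Sum>(c, xs)\<leftarrow>L. c * ?m xs s)" by blast
    let ?P = "concat (map (\<lambda>(c, xs). map (\<lambda>(d, ys). (c * d, xs @ ys)) L) K)"
    have 1: "(\<Sum>(d, ys)\<leftarrow>map (\<lambda>(d, ys). (c * d, xs @ ys)) L. d * ?m ys s) = c * ?m xs s * g s"
      for c xs s
      unfolding KL(4)[rule_format] by (induction L) (auto simp: algebra_simps)
    have "(\<Sum>(c, xs)\<leftarrow>?P. c * ?m xs s) = f s * g s" for s
      unfolding KL(2)[rule_format]
    proof (induction K)
      case (Cons a K)
      then show ?case using 1[where c = "fst a" and xs = "snd a" and s = s]
        by (simp add: case_prod_unfold algebra_simps del: map_map)
    qed simp
    moreover have "snd ` set ?P \<subseteq> lists B" using KL(1,3) by fastforce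
    ultimately show ?case by (intro exI[of _ ?P]) metis
  qed
  then obtain L where L: "snd ` set L \<subseteq> lists B" "\<And>s. f s = (\<Sum>(c, xs)\<leftarrow>L. c * ?m xs s)" by blast
  let ?a = "\<lambda>L xs. \<Sum>(c, ys)\<leftarrow>L. if ys = xs then c else 0"
  have "(\<Sum>(c, xs)\<leftarrow>L'. c * ?m xs s) = (\<Sum>xs\<in>T. ?a L' xs * ?m xs s)"
    if "finite T" "snd ` set L' \<subseteq> T" for T L' s
    using that(2)
  proof (induction L')
    case (Cons p L')
    have "(\<Sum>xs\<in>T. (if snd p = xs then fst p else 0) * ?m xs s) = fst p * ?m (snd p) s"
      using Cons.prems that(1) by (subst sum.remove[of _ "snd p"]) (auto intro!: sum.neutral split: if_splits)
    with Cons show ?case by (simp add: case_prod_unfold distrib_right sum.distrib)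
  qed simp
  then have "f s = (\<Sum>xs\<in>snd ` set L. ?a L xs * ?m xs s)" for s
    unfolding L(2) by blast
  with L(1) show ?thesis by (intro exI[of _ "snd ` set L"] exI[of _ "?a L"]) auto
qed

definition function_ideal :: "('x \<Rightarrow> complex) set \<Rightarrow> ('x \<Rightarrow> complex) set \<Rightarrow> bool" where
  "function_ideal B J \<longleftrightarrow> J \<subseteq> polynomials_in B \<and> (\<lambda>_. 0) \<in> J \<and>
     (\<forall>f\<in>J. \<forall>g\<in>J. (\<lambda>x. f x + g x) \<in> J) \<and>
     (\<forall>f\<in>J. \<forall>h\<in>polynomials_in B. (\<lambda>x. h x * f x) \<in> J)"

lemma function_idealD:
  assumes "function_ideal B J"
  shows "J \<subseteq> polynomials_in B" "(\<lambda>_. 0) \<in> J"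
    "\<And>f g. f \<in> J \<Longrightarrow> g \<in> J \<Longrightarrow> (\<lambda>x. f x + g x) \<in> J"
    "\<And>f h. f \<in> J \<Longrightarrow> h \<in> polynomials_in B \<Longrightarrow> (\<lambda>x. h x * f x) \<in> J"
  using assms unfolding function_ideal_def by blast+

lemma function_idealI:
  assumes "\<And>f. f \<in> J \<Longrightarrow> f \<in> polynomials_in B" "(\<lambda>_. 0) \<in> J"
    "\<And>f g. f \<in> J \<Longrightarrow> g \<in> J \<Longrightarrow> (\<lambda>x. f x + g x) \<in> J"
    "\<And>f h. f \<in> J \<Longrightarrow> h \<in> polynomials_in B \<Longrightarrow> (\<lambda>x. h x * f x) \<in> J"
  shows "function_ideal B J"
  unfolding function_ideal_def using assms by (intro conjI ballI subsetI) assumption+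

lemma function_ideal_diff:
  assumes "function_ideal B J" "f \<in> J" "g \<in> J"
  shows "(\<lambda>x. f x - g x) \<in> J"
  using function_idealD(3)[OF assms(1,2) function_idealD(4)[OF assms(1,3) polynomials_in.const[of "-1"]]]
  by simp

lemma function_ideal_sum:
  assumes "function_ideal B J" "finite I" "\<And>i. i \<in> I \<Longrightarrow> f i \<in> J"
  shows "(\<lambda>x. \<Sum>i\<in>I. f i x) \<in> J"
  using assms(2,3)
proof (induction I rule: finite_induct)
  case empty
  then show ?case using function_idealD(2)[OF assms(1)] by simp
next
  case (insert i I)
  then show ?case using function_idealD(3)[OF assms(1), of "f i" "\<lambda>x. \<Sum>i\<in>I. f i x"] by simp
qed

lemma function_ideal_chain_Union:
  assumes "\<C> \<noteq> {}" "\<And>X. X \<in> \<C> \<Longrightarrow> function_ideal B X"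
    and chain: "\<And>X Y. X \<in> \<C> \<Longrightarrow> Y \<in> \<C> \<Longrightarrow> X \<subseteq> Y \<or> Y \<subseteq> X"
  shows "function_ideal B (\<Union>\<C>)"
proof (rule function_idealI)
  show "f \<in> polynomials_in B" if "f \<in> \<Union>\<C>" for f
    using that function_idealD(1)[OF assms(2)] by auto
  obtain X where "X \<in> \<C>" using assms(1) by auto
  then show "(\<lambda>_. 0) \<in> \<Union>\<C>" using function_idealD(2)[OF assms(2)] by auto
  fix f h assume "f \<in> \<Union>\<C>" "h \<in> polynomials_in B"
  then obtain X where X: "X \<in> \<C>" "f \<in> X" by auto
  show "(\<lambda>x. h x * f x) \<in> \<Union>\<C>"
    by (rule UnionI[OF X(1) function_idealD(4)[OF assms(2)[OF X(1)] X(2) \<open>h \<in> _\<close>]])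
next
  fix f g assume "f \<in> \<Union>\<C>" "g \<in> \<Union>\<C>"
  then obtain X Y where XY: "X \<in> \<C>" "f \<in> X" "Y \<in> \<C>" "g \<in> Y" by auto
  from chain[OF XY(1,3)] obtain Z where Z: "Z \<in> \<C>" "f \<in> Z" "g \<in> Z"
    using XY by auto
  show "(\<lambda>x. f x + g x) \<in> \<Union>\<C>"
    by (rule UnionI[OF Z(1) function_idealD(3)[OF assms(2)[OF Z(1)] Z(2,3)]])
qed

lemma function_ideal_adjoin:
  assumes M: "function_ideal B M" and f: "f \<in> polynomials_in B"
  defines "X \<equiv> {\<lambda>x. m x + r x * f x | m r. m \<in> M \<and> r \<in> polynomials_in B}"
  shows "function_ideal B X" "M \<subseteq> X" "f \<in> X"
proof -
  note idM = function_idealD[OF M]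
  have XI: "(\<lambda>x. m x + r x * f x) \<in> X" if "m \<in> M" "r \<in> polynomials_in B" for m r
    unfolding X_def by (rule CollectI, rule exI[of _ m], rule exI[of _ r]) (simp add: that)
  have XE: "\<exists>m r. m \<in> M \<and> r \<in> polynomials_in B \<and> g = (\<lambda>x. m x + r x * f x)" if "g \<in> X" for g
    using that unfolding X_def by auto
  show "M \<subseteq> X"
  proof
    fix m assume "m \<in> M"
    then show "m \<in> X" using XI[OF _ polynomials_in.const[of 0], of m] by simp
  qed
  show "f \<in> X" using XI[OF idM(2) polynomials_in.const[of 1]] by simp
  show "function_ideal B X"
  proof (rule function_idealI)
    show "(\<lambda>_. 0) \<in> X" using XI[OF idM(2) polynomials_in.const[of 0]] by simp
    fix g assume "g \<in> X"
    then obtain m r where g: "m \<in> M" "r \<in> polynomials_in B" "g = (\<lambda>x. m x + r x * f x)"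
      using XE by metis
    show "g \<in> polynomials_in B"
      unfolding g(3) using g(1) idM(1)
      by (intro polynomials_in.add polynomials_in.mult f g(2)) auto
    show "(\<lambda>x. g x + h x) \<in> X" if "h \<in> X" for h
    proof -
      from that obtain m' r' where h: "m' \<in> M" "r' \<in> polynomials_in B"
        "h = (\<lambda>x. m' x + r' x * f x)" using XE by metis
      have "(\<lambda>x. g x + h x) = (\<lambda>x. (m x + m' x) + (r x + r' x) * f x)"
        unfolding g(3) h(3) by (simp add: algebra_simps)
      with XI[OF idM(3)[OF g(1) h(1)] polynomials_in.add[OF g(2) h(2)]] show ?thesis by simp
    qed
    show "(\<lambda>x. h x * g x) \<in> X" if "h \<in> polynomials_in B" for h
    proof -
      have "(\<lambda>x. h x * g x) = (\<lambda>x. h x * m x + (h x * r x) * f x)"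
        unfolding g(3) by (simp add: algebra_simps)
      with XI[OF idM(4)[OF g(1) that] polynomials_in.mult[OF that g(2)]] show ?thesis by simp
    qed
  qed
qed

text \<open>
  By Zorn's lemma. The last property expresses the maximality: every element outside \<open>M\<close> is invertible
  modulo \<open>M\<close>.
\<close>

lemma function_ideal_in_maximal:
  assumes "function_ideal B J" "(\<lambda>_. 1) \<notin> J"
  obtains M where "function_ideal B M" "J \<subseteq> M" "(\<lambda>_. 1) \<notin> M"
    "\<And>f. f \<in> polynomials_in B \<Longrightarrow> f \<notin> M \<Longrightarrow> \<exists>r\<in>polynomials_in B. (\<lambda>x. r x * f x - 1) \<in> M"
proof -
  define A where "A = {I. function_ideal B I \<and> J \<subseteq> I \<and> (\<lambda>_. 1) \<notin> I}"
  have "\<exists>M\<in>A. \<forall>X\<in>A. M \<subseteq> X \<longrightarrow> X = M"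
  proof (rule subset_Zorn_nonempty)
    show "A \<noteq> {}" using assms by (auto simp: A_def)
  next
    fix \<C> assume C: "\<C> \<noteq> {}" "subset.chain A \<C>"
    then have sub: "\<C> \<subseteq> A" by (auto simp: subset_chain_def)
    then have "function_ideal B (\<Union>\<C>)"
      using C by (intro function_ideal_chain_Union) (auto simp: subset_chain_def A_def)
    then show "\<Union>\<C> \<in> A" using C(1) sub by (auto simp: A_def)
  qed
  then obtain M where "M \<in> A" and max: "\<And>X. X \<in> A \<Longrightarrow> M \<subseteq> X \<Longrightarrow> X = M" by auto
  then have M: "function_ideal B M" "J \<subseteq> M" "(\<lambda>_. 1) \<notin> M" by (auto simp: A_def)
  show thesis
  proof (rule that[OF M])
    fix f assume f: "f \<in> polynomials_in B" "f \<notin> M"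
    define X where "X = {\<lambda>x. m x + r x * f x | m r. m \<in> M \<and> r \<in> polynomials_in B}"
    note X = function_ideal_adjoin[OF M(1) f(1), folded X_def]
    have "(\<lambda>_. 1) \<in> X"
    proof (rule ccontr)
      assume "(\<lambda>_. 1) \<notin> X"
      then have "X \<in> A" using X(1,2) M(2) by (auto simp: A_def)
      with max X(2,3) f(2) show False by auto
    qed
    then obtain m r where mr: "m \<in> M" "r \<in> polynomials_in B" "(\<lambda>_. 1) = (\<lambda>x. m x + r x * f x)"
      unfolding X_def by auto
    have "m x = 1 - r x * f x" for x using fun_cong[OF mr(3), of x] by (simp add: algebra_simps)
    then have "(\<lambda>x. r x * f x - 1) = (\<lambda>x. (-1) * m x)" by auto
    also have "\<dots> \<in> M" by (rule function_idealD(4)[OF M(1) mr(1) polynomials_in.const])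
    finally show "\<exists>r\<in>polynomials_in B. (\<lambda>x. r x * f x - 1) \<in> M" using mr(2) by auto
  qed
qed

section \<open>Nullstellensatz over the complex numbers\<close>

text \<open>
  If every \<open>x - d\<close> is invertible modulo \<open>M\<close>, then so is every nonzero polynomial in \<open>x\<close>, because it
  splits into factors \<open>x - d\<close>. Over a field this says that what is not a constant is transcendental.
\<close>

lemma polynomial_not_in_proper_ideal:
  fixes q :: "complex poly"
  assumes M: "function_ideal B M" "(\<lambda>_. 1) \<notin> M" and x: "x \<in> polynomials_in B"
    and inv: "\<And>d. \<exists>r\<in>polynomials_in B. (\<lambda>s. r s * (x s - d) - 1) \<in> M"
    and q: "q \<noteq> 0"
  shows "(\<lambda>s. poly q (x s)) \<notin> M"
  using q
proof (induction "degree q" arbitrary: q rule: less_induct)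
  case less
  note idM = function_idealD[OF M(1)]
  show ?case
  proof (cases "degree q = 0")
    case True
    then obtain a where a: "q = [:a:]" by (metis degree_eq_zeroE)
    show ?thesis
    proof
      assume "(\<lambda>s. poly q (x s)) \<in> M"
      from idM(4)[OF this polynomials_in.const[of "inverse a"]] show False
        using a less.prems M(2) by simp
    qed
  next
    case False
    then obtain d where "poly q d = 0"
      using fundamental_theorem_of_algebra[of q] constant_degree[of q] by auto
    then obtain p where p: "q = [:-d, 1:] * p" by (auto simp: poly_eq_0_iff_dvd)
    from less.prems have "p \<noteq> 0" by (auto simp: p)
    then have deg: "degree p < degree q" unfolding p by (subst degree_mult_eq) auto
    obtain r where r: "r \<in> polynomials_in B" "(\<lambda>s. r s * (x s - d) - 1) \<in> M" using inv by auto
    show ?thesis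
    proof
      assume qM: "(\<lambda>s. poly q (x s)) \<in> M"
      \<comment> \<open>\<open>x - d\<close> is invertible modulo \<open>M\<close>, so it cancels.\<close>
      have "(\<lambda>s. r s * poly q (x s) - poly p (x s) * (r s * (x s - d) - 1)) \<in> M"
        by (rule function_ideal_diff[OF M(1) idM(4)[OF qM r(1)]
              idM(4)[OF r(2) polynomials_in_poly[OF x]]])
      moreover have "r s * poly q (x s) - poly p (x s) * (r s * (x s - d) - 1) = poly p (x s)" for s
        by (simp add: p algebra_simps)
      ultimately show False using less.hyps[OF deg \<open>p \<noteq> 0\<close>] by simp
    qed
  qed
qed

text \<open>
  Residue fields of an algebra of countable dimension are trivial over an uncountable algebraically
  closed field. Otherwise the inverses of the elements \<open>x - c\<close>, for all complex \<open>c\<close>, would be uncountably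
  many elements of the residue field. Infinitely many of them lie in the span of the same finite set
  of monomials, so they are linearly dependent, which is an algebraic equation for \<open>x\<close>.
\<close>

lemma residue_value_exists:
  assumes B: "countable B" and M: "function_ideal B M" "(\<lambda>_. 1) \<notin> M"
    and max: "\<And>f. f \<in> polynomials_in B \<Longrightarrow> f \<notin> M \<Longrightarrow>
      \<exists>r\<in>polynomials_in B. (\<lambda>x. r x * f x - 1) \<in> M"
    and x: "x \<in> polynomials_in B"
  shows "\<exists>c. (\<lambda>s. x s - c) \<in> M"
proof (rule ccontr)
  assume "\<nexists>c. (\<lambda>s. x s - c) \<in> M"
  then have inv: "\<exists>r\<in>polynomials_in B. (\<lambda>s. r s * (x s - c) - 1) \<in> M" for c
    using max[OF polynomials_in_diff[OF x polynomials_in.const[of c]]] by simp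
  then obtain r where r: "\<And>c. r c \<in> polynomials_in B" "\<And>c. (\<lambda>s. r c s * (x s - c) - 1) \<in> M"
    by metis
  let ?m = "\<lambda>(xs :: ('a \<Rightarrow> complex) list) s. prod_list (map (\<lambda>x. x s) xs)"
  have "\<forall>c. \<exists>T \<alpha>. finite T \<and> T \<subseteq> lists B \<and> (\<forall>s. r c s = (\<Sum>xs\<in>T. \<alpha> xs * ?m xs s))"
    by (rule allI) (rule polynomials_in_monomial_expansion[OF r(1)])
  from choice[OF this] obtain T where "\<forall>c. \<exists>\<alpha>. finite (T c) \<and> T c \<subseteq> lists B \<and>
      (\<forall>s. r c s = (\<Sum>xs\<in>T c. \<alpha> xs * ?m xs s))" by (rule exE)
  from choice[OF this] obtain \<alpha> where "\<forall>c. finite (T c) \<and> T c \<subseteq> lists B \<and>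
      (\<forall>s. r c s = (\<Sum>xs\<in>T c. \<alpha> c xs * ?m xs s))" by (rule exE)
  then have T: "\<And>c. finite (T c)" "\<And>c. T c \<subseteq> lists B"
    "\<And>c s. r c s = (\<Sum>xs\<in>T c. \<alpha> c xs * ?m xs s)" by auto
  \<comment> \<open>Only countably many finite sets of monomials compete for uncountably many \<open>c\<close>.\<close>
  have "range T \<subseteq> {U. finite U \<and> U \<subseteq> lists B}" using T(1,2) by blast
  then have "countable (range T)"
    by (rule countable_subset) (rule countable_Collect_finite_subset[OF countable_lists[OF B]])
  moreover have "(\<Union>U\<in>range T. T -` {U}) = UNIV" by auto
  ultimately obtain U where U: "U \<in> range T" "uncountable (T -` {U})"
    using uncountable_UNIV_complex countable_UN[of "range T" "\<lambda>U. T -` {U}"] by metis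
  then have "infinite (T -` {U})" using countable_finite by metis
  then obtain C where C: "C \<subseteq> T -` {U}" "finite C" "card C = Suc (card U)"
    using infinite_arbitrarily_large by metis
  have "finite U" using U(1) T(1) by auto
  then obtain u where u: "\<exists>c\<in>C. u c \<noteq> 0" "\<forall>xs\<in>U. (\<Sum>c\<in>C. u c * \<alpha> c xs) = 0"
    using underdetermined_system_solvable[of U C \<alpha>] C by auto
  have dep: "(\<Sum>c\<in>C. u c * r c s) = 0" for s
  proof -
    have "(\<Sum>c\<in>C. u c * r c s) = (\<Sum>c\<in>C. \<Sum>xs\<in>U. u c * \<alpha> c xs * ?m xs s)"
      using C(1) by (intro sum.cong) (auto simp: T(3) sum_distrib_left mult.assoc)
    also have "\<dots> = (\<Sum>xs\<in>U. (\<Sum>c\<in>C. u c * \<alpha> c xs) * ?m xs s)"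
      by (subst sum.swap) (simp add: sum_distrib_right)
    finally show ?thesis using u(2) by simp
  qed
  \<comment> \<open>Clearing the denominators \<open>x - c\<close> in this relation gives a polynomial in \<open>x\<close> that lies in \<open>M\<close>.\<close>
  define q where "q = (\<Sum>c\<in>C. smult (u c) (\<Prod>d\<in>C-{c}. [:-d, 1:]))"
  have poly_q: "poly q z = (\<Sum>c\<in>C. u c * (\<Prod>d\<in>C-{c}. z - d))" for z
    by (simp add: q_def poly_sum poly_prod)
  have "(\<lambda>s. \<Sum>c\<in>C. (u c * (\<Prod>d\<in>C-{c}. x s - d)) * (r c s * (x s - c) - 1)) \<in> M"
    by (rule function_ideal_sum[OF M(1) C(2)], rule function_idealD(4)[OF M(1) r(2)])
      (intro polynomials_in.mult[OF polynomials_in.const] polynomials_in_prod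
        polynomials_in_diff[OF x polynomials_in.const])
  moreover have "(\<Sum>c\<in>C. (u c * (\<Prod>d\<in>C-{c}. x s - d)) * (r c s * (x s - c) - 1)) =
      - poly q (x s)" for s
  proof -
    have "(\<Sum>c\<in>C. (u c * (\<Prod>d\<in>C-{c}. x s - d)) * (r c s * (x s - c))) =
        (\<Sum>c\<in>C. (\<Prod>d\<in>C. x s - d) * (u c * r c s))"
      using C(2) by (intro sum.cong) (auto simp: prod.remove)
    also have "\<dots> = 0" using dep by (simp flip: sum_distrib_left)
    finally show ?thesis by (simp add: poly_q right_diff_distrib sum_subtractf)
  qed
  ultimately have "(\<lambda>s. - poly q (x s)) \<in> M" by simp
  from function_ideal_diff[OF M(1) function_idealD(2)[OF M(1)] this]
  have "(\<lambda>s. poly q (x s)) \<in> M" by simp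
  moreover have "q \<noteq> 0"
  proof -
    obtain c where c: "c \<in> C" "u c \<noteq> 0" using u(1) by auto
    have "poly q c = u c * (\<Prod>d\<in>C-{c}. c - d)"
      unfolding poly_q using C(2) c(1)
      by (subst sum.remove[of _ c]) (auto intro!: sum.neutral)
    also have "\<dots> \<noteq> 0" using c C(2) by auto
    finally show ?thesis by auto
  qed
  ultimately show False using polynomial_not_in_proper_ideal[OF M x inv] by auto
qed

text \<open>
  The assumption on the coordinates says that every assignment of values to the generators comes from
  a point. The point is the one whose coordinates are the residues of the generators modulo a maximal
  ideal.
\<close>

theorem nullstellensatz:
  assumes B: "countable B" and coordinates: "\<And>c. \<exists>s. \<forall>b\<in>B. b s = c b"
    and J: "function_ideal B J" "(\<lambda>_. 1) \<notin> J"
  shows "\<exists>s. \<forall>f\<in>J. f s = 0"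
proof -
  obtain M where M: "function_ideal B M" "J \<subseteq> M" "(\<lambda>_. 1) \<notin> M"
    and max: "\<And>f. f \<in> polynomials_in B \<Longrightarrow> f \<notin> M \<Longrightarrow>
      \<exists>r\<in>polynomials_in B. (\<lambda>x. r x * f x - 1) \<in> M"
    using function_ideal_in_maximal[OF J] by metis
  have "\<exists>c. (\<lambda>s. b s - c) \<in> M" if "b \<in> B" for b
    by (rule residue_value_exists[OF B M(1,3) max polynomials_in.gen[OF that]])
  then obtain c where c: "\<And>b. b \<in> B \<Longrightarrow> (\<lambda>s. b s - c b) \<in> M" by metis
  obtain s where s: "\<And>b. b \<in> B \<Longrightarrow> b s = c b" using coordinates[of c] by auto
  have *: "(\<lambda>t. f t - f s) \<in> M" if "f \<in> polynomials_in B" for f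
    using that
  proof induction
    case (const a)
    then show ?case using function_idealD(2)[OF M(1)] by simp
  next
    case (gen b)
    then show ?case using c s by simp
  next
    case (add f g)
    from function_idealD(3)[OF M(1) add.IH] show ?case by (simp add: algebra_simps)
  next
    case (mult f g)
    have "(\<lambda>t. g t * (f t - f s) + f s * (g t - g s)) \<in> M"
      by (intro function_idealD(3)[OF M(1)] function_idealD(4)[OF M(1)] mult polynomials_in.const)
    then show ?case by (simp add: algebra_simps)
  qed
  have "f s = 0" if f: "f \<in> J" for f
  proof (rule ccontr)
    assume "f s \<noteq> 0"
    have fM: "f \<in> M" using f M(2) by auto
    then have "(\<lambda>t. f t - (f t - f s)) \<in> M"
      using function_idealD(1)[OF M(1)] by (intro function_ideal_diff[OF M(1)] *) auto
    from function_idealD(4)[OF M(1) this polynomials_in.const[of "inverse (f s)"]]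
    have "(\<lambda>t. inverse (f s) * (f t - (f t - f s))) \<in> M" .
    with \<open>f s \<noteq> 0\<close> M(3) show False by simp
  qed
  then show ?thesis by auto
qed

section \<open>Lines and determinants in the plane\<close>

definition columns :: "complex^2 \<Rightarrow> complex^2 \<Rightarrow> complex^2^2" where
  "columns v w = vector [vector [v $ 1, w $ 1], vector [v $ 2, w $ 2]]"

lemma columns_nth [simp]:
  "columns v w $ 1 $ 1 = v $ 1" "columns v w $ 1 $ 2 = w $ 1"
  "columns v w $ 2 $ 1 = v $ 2" "columns v w $ 2 $ 2 = w $ 2"
  by (simp_all add: columns_def)

lemma vec2_eq_iff: "v = w \<longleftrightarrow> v $ 1 = w $ 1 \<and> v $ 2 = w $ 2" for v w :: "'a^2"
  by (simp add: vec_eq_iff forall_2)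

lemma mat2_mult_nth: "(A ** B) $ i $ j = A $ i $ 1 * B $ 1 $ j + A $ i $ 2 * B $ 2 $ j"
  for A B :: "complex^2^2"
  by (simp add: matrix_matrix_mult_def sum_2)

lemma mat2_vector_nth: "(A *v x) $ i = A $ i $ 1 * x $ 1 + A $ i $ 2 * x $ 2"
  for A :: "complex^2^2"
  by (simp add: matrix_vector_mult_def sum_2)

lemma mat_1_nth:
  "(mat 1 :: complex^2^2) $ 1 $ 1 = 1" "(mat 1 :: complex^2^2) $ 1 $ 2 = 0"
  "(mat 1 :: complex^2^2) $ 2 $ 1 = 0" "(mat 1 :: complex^2^2) $ 2 $ 2 = 1"
  by (simp_all add: mat_def)

lemma vec_det_mat_vector: "vec_det (A *v v) (A *v w) = det A * vec_det v w"
  by (simp add: vec_det_eq det_2 mat2_vector_nth algebra_simps)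

lemma vec_det_scale: "vec_det (a *s v) (b *s w) = a * b * vec_det v w"
  by (simp add: vec_det_eq algebra_simps)

lemma vec_det_0 [simp]: "vec_det 0 v = 0" "vec_det v 0 = 0"
  by (simp_all add: vec_det_eq)

lemma span_scale_eq: "c \<noteq> 0 \<Longrightarrow> vec.span {c *s v} = vec.span {v}"
  for v :: "complex^'n"
proof -
  assume c: "c \<noteq> 0"
  have "v = inverse c *s (c *s v)" using c by simp
  then have "v \<in> vec.span {c *s v}" unfolding vec.span_singleton by blast
  moreover have "c *s v \<in> vec.span {v}" unfolding vec.span_singleton by blast
  ultimately show ?thesis by (intro vec.span_eq[THEN iffD2]) auto
qed

lemma span_eqD:
  assumes "vec.span {w} = vec.span {v}" "w \<noteq> 0"
  obtains c where "c \<noteq> 0" "w = c *s v"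
proof -
  have "w \<in> vec.span {v}" using assms(1) vec.span_base[of w "{w}"] by auto
  then obtain c where "w = c *s v" by (auto simp: vec.span_singleton)
  with assms(2) that show thesis by (metis vector_smult_lzero)
qed

lemma span_eq_if_vec_det_0:
  assumes "vec_det v w = 0" "v \<noteq> 0" "w \<noteq> 0"
  shows "vec.span {v} = vec.span {w}"
proof -
  have *: "v $ 1 * w $ 2 = v $ 2 * w $ 1" using assms(1) by (simp add: vec_det_eq)
  obtain c where c: "v = c *s w"
  proof (cases "w $ 1 = 0")
    case True
    with assms(3) have "w $ 2 \<noteq> 0" by (simp add: vec2_eq_iff)
    with * True that[of "v $ 2 / w $ 2"] show thesis by (simp add: vec2_eq_iff)
  next
    case False
    with * that[of "v $ 1 / w $ 1"] show thesis by (simp add: vec2_eq_iff field_simps)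
  qed
  with assms(2) have "c \<noteq> 0" by auto
  with c show ?thesis using span_scale_eq by simp
qed

lemma image_span_singleton:
  "(\<lambda>x. A *v x) ` vec.span {v} = vec.span {A *v v}" for A :: "complex^2^2"
proof -
  have "A *v (c *s v) = c *s (A *v v)" for c
    by (simp add: vec2_eq_iff mat2_vector_nth algebra_simps)
  then show ?thesis unfolding vec.span_singleton by (auto simp: image_iff)
qed

section \<open>Stokes data and normalized frames\<close>

text \<open>
  The matrix in the \<open>i\<close>-th position of Stokes data: the parity of \<open>i\<close> decides between the upper and the
  lower unipotent group.
\<close>

definition unipotent :: "nat \<Rightarrow> complex \<Rightarrow> complex^2^2" where
  "unipotent i a = (if odd i then vector [vector [1, a], vector [0, 1]]
     else vector [vector [1, 0], vector [a, 1]])"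

definition stokes_entry :: "nat \<Rightarrow> complex^2^2 \<Rightarrow> complex" where
  "stokes_entry i A = (if odd i then A $ 1 $ 2 else A $ 2 $ 1)"

lemma stokes_entry_unipotent [simp]: "stokes_entry i (unipotent i a) = a"
  by (simp add: stokes_entry_def unipotent_def)

lemma unipotent_in: "unipotent i a \<in> (if odd i then upper_unipotent else lower_unipotent)"
  by (simp add: unipotent_def upper_unipotent_def lower_unipotent_def)

lemma unipotent_stokes_entry:
  "A \<in> (if odd i then upper_unipotent else lower_unipotent) \<Longrightarrow> unipotent i (stokes_entry i A) = A"
  by (auto simp: unipotent_def stokes_entry_def upper_unipotent_def lower_unipotent_def
      vec2_eq_iff split: if_splits)

text \<open>
  For Stokes data \<open>S\<close> these are the columns of the inverses of the partial products \<open>S i ** \<dots> ** S 1\<close>: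
  passing from one partial product to the next replaces only one column, by the recursion below. The
  lines that they span form the point of the Sibuya space attached to \<open>S\<close>. The vector with index 0, the
  predecessor of the first one in the recursion, will span the last of these lines.
\<close>

fun stokes_vector :: "(nat \<Rightarrow> complex^2^2) \<Rightarrow> nat \<Rightarrow> complex^2" where
  "stokes_vector S 0 = vector [0, 1]"
| "stokes_vector S (Suc 0) = vector [1, 0]"
| "stokes_vector S (Suc (Suc i)) =
     stokes_vector S i - stokes_entry (Suc i) (S (Suc i)) *s stokes_vector S (Suc i)"

lemma vec_det_stokes_vector:
  "vec_det (stokes_vector S i) (stokes_vector S (Suc i)) = (- 1) ^ Suc i"
proof (induction i)
  case 0
  show ?case by (simp add: vec_det_eq)
next
  case (Suc i)
  have "vec_det v (w - a *s v) = - vec_det w v" for a v w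
    by (simp add: vec_det_eq algebra_simps)
  with Suc show ?case by simp
qed

definition frame_matrix :: "(nat \<Rightarrow> complex^2) \<Rightarrow> nat \<Rightarrow> complex^2^2" where
  "frame_matrix u i = (if odd i then columns (u i) (u (Suc i)) else columns (u (Suc i)) (u i))"

text \<open>
  Multiplying \<open>frame_matrix (stokes_vector S) (Suc m)\<close> by the matrix \<open>S (Suc m)\<close> undoes the recursion
  step, so the frame matrix is the inverse of the partial product.
\<close>

lemma frame_matrix_stokes_product:
  assumes "\<And>i. i \<in> {1..m} \<Longrightarrow> S i \<in> (if odd i then upper_unipotent else lower_unipotent)"
  shows "frame_matrix (stokes_vector S) m ** stokes_product S m = mat 1"
  using assms
proof (induction m)
  case 0
  show ?case
    by (simp add: frame_matrix_def vec2_eq_iff mat2_mult_nth mat_1_nth)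
next
  case (Suc m)
  have S: "S (Suc m) \<in> (if odd (Suc m) then upper_unipotent else lower_unipotent)"
    using Suc.prems[of "Suc m"] by auto
  have "frame_matrix (stokes_vector S) (Suc m) ** S (Suc m) = frame_matrix (stokes_vector S) m"
    using S by (cases "odd m")
      (auto simp: frame_matrix_def vec2_eq_iff mat2_mult_nth upper_unipotent_def
        lower_unipotent_def stokes_entry_def)
  with Suc show ?case by (simp add: matrix_mul_assoc)
qed

text \<open>
  A frame starts at the last line, goes once around the cycle and ends at the first line.
\<close>

definition cyclic_index :: "nat \<Rightarrow> nat \<Rightarrow> nat" where
  "cyclic_index n i = (if i = 0 then n else if i = Suc n then 1 else i)"

text \<open>
  The vectors \<open>u 0\<close> and \<open>u n\<close> span the same line but may differ by a factor, and so may \<open>u 1\<close> and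
  \<open>u (Suc n)\<close>. These factors carry the multi-ratio; a cyclic normalization, without them, would force it
  to be 1. The signs are those of the vectors of Stokes data.
\<close>

definition normalized_frame ::
  "nat \<Rightarrow> (nat \<Rightarrow> (complex^2) set) \<Rightarrow> (nat \<Rightarrow> complex^2) \<Rightarrow> bool" where
  "normalized_frame n p u \<longleftrightarrow>
     (\<forall>i\<le>Suc n. p (cyclic_index n i) = vec.span {u i}) \<and>
     (\<forall>i\<le>n. vec_det (u i) (u (Suc i)) = (- 1) ^ Suc i)"

lemma normalized_frameD:
  assumes "normalized_frame n p u"
  shows "i \<le> Suc n \<Longrightarrow> p (cyclic_index n i) = vec.span {u i}"
    "i \<le> n \<Longrightarrow> vec_det (u i) (u (Suc i)) = (- 1) ^ Suc i"
    "i \<le> Suc n \<Longrightarrow> u i \<noteq> 0"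
proof -
  show 1: "vec_det (u i) (u (Suc i)) = (- 1) ^ Suc i" if "i \<le> n" for i
    using assms that by (simp add: normalized_frame_def)
  show "p (cyclic_index n i) = vec.span {u i}" if "i \<le> Suc n"
    using assms that by (simp add: normalized_frame_def)
  show "u i \<noteq> 0" if "i \<le> Suc n"
  proof
    assume "u i = 0"
    with 1[of i] 1[of "i - 1"] that show False
      by (cases "i \<le> n") (auto simp: le_Suc_eq)
  qed
qed

lemma normalized_frame_spans:
  assumes "normalized_frame n p u"
  shows "spans n u p"
  unfolding spans_def
proof
  fix i assume "i \<in> {1..n}"
  then show "u i \<noteq> 0 \<and> p i = vec.span {u i}"
    using normalized_frameD(1,3)[OF assms, of i] by (auto simp: cyclic_index_def)
qed

text \<open>
  Pairing the recursion \<open>u (Suc i) = u (i - 1) - a *s u i\<close> with \<open>u (i - 1)\<close> gives this value of \<open>a\<close>.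
\<close>

definition stokes_of :: "nat \<Rightarrow> (nat \<Rightarrow> complex^2) \<Rightarrow> nat \<Rightarrow> complex^2^2" where
  "stokes_of n u = (\<lambda>i\<in>{1..n}. unipotent i ((- 1) ^ Suc i * vec_det (u (i - 1)) (u (Suc i))))"

text \<open>
  Since \<open>x\<close> and \<open>z\<close> have the same determinant with \<open>y\<close>, they differ by a multiple of \<open>y\<close>; the determinant
  with \<open>x\<close> shows which.
\<close>

lemma frame_recursion:
  assumes "vec_det x y = e" "vec_det y z = - e" "e * e = 1"
  shows "z = x + (e * vec_det x z) *s y"
proof -
  have e: "x $ 1 * y $ 2 - x $ 2 * y $ 1 = e" "y $ 1 * z $ 2 - y $ 2 * z $ 1 = - e"
    using assms(1,2) by (simp_all add: vec_det_eq)
  have "e * z $ 1 + (- e) * x $ 1 = vec_det x z * y $ 1"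
    unfolding e(2)[symmetric] unfolding e(1)[symmetric] by (simp add: vec_det_eq algebra_simps)
  moreover have "e * z $ 2 + (- e) * x $ 2 = vec_det x z * y $ 2"
    unfolding e(2)[symmetric] unfolding e(1)[symmetric] by (simp add: vec_det_eq algebra_simps)
  ultimately have *: "e * (z $ i - x $ i) = vec_det x z * y $ i" if "i = 1 \<or> i = 2" for i
    using that by (auto simp: algebra_simps)
  have "z $ i - x $ i = e * vec_det x z * y $ i" if "i = 1 \<or> i = 2" for i
    using arg_cong[OF *[OF that], of "(*) e"] assms(3) by (simp flip: mult.assoc)
  then show ?thesis by (simp add: vec2_eq_iff algebra_simps)
qed

lemma stokes_of_in_stokes_data: "stokes_of (2*k) u \<in> stokes_data k"
  using unipotent_in by (auto simp: stokes_of_def stokes_data_def)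

text \<open>
  A normalized frame satisfies the same recursion as the vectors of its Stokes data, so the two differ
  by the linear map that matches the initial vectors.
\<close>

lemma normalized_frame_eq_image:
  assumes fr: "normalized_frame n p u" and "i \<le> Suc n"
  shows "u i = columns (u 1) (u 0) *v stokes_vector (stokes_of n u) i"
  using assms(2)
proof (induction i rule: less_induct)
  case (less i)
  consider "i = 0" | "i = 1" | m where "i = Suc (Suc m)" by (metis One_nat_def old.nat.exhaust)
  then show ?case
  proof cases
    case (3 m)
    let ?A = "columns (u 1) (u 0)" and ?S = "stokes_of n u"
    have "u i = u m + ((- 1) ^ Suc m * vec_det (u m) (u i)) *s u (Suc m)"
    proof (rule frame_recursion)
      show "vec_det (u m) (u (Suc m)) = (- 1) ^ Suc m"
        using normalized_frameD(2)[OF fr, of m] less.prems 3 by auto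
      show "vec_det (u (Suc m)) (u i) = - ((- 1) ^ Suc m)"
        using normalized_frameD(2)[OF fr, of "Suc m"] less.prems 3 by auto
    qed (simp flip: power_mult_distrib)
    also have "\<dots> = u m - ((- 1) ^ m * vec_det (u m) (u i)) *s u (Suc m)"
      by (simp add: vec2_eq_iff)
    also have "(- 1) ^ m * vec_det (u m) (u i) = stokes_entry (Suc m) (?S (Suc m))"
      using less.prems 3 by (simp add: stokes_of_def)
    also have "u m = ?A *v stokes_vector ?S m"
      by (rule less.IH) (use less.prems 3 in simp_all)
    also have "u (Suc m) = ?A *v stokes_vector ?S (Suc m)"
      by (rule less.IH) (use less.prems 3 in simp_all)
    finally show ?thesis
      unfolding 3 by (simp add: vec2_eq_iff mat2_vector_nth algebra_simps)
  qed (simp_all add: vec2_eq_iff mat2_vector_nth)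
qed

lemma det_frame:
  assumes "normalized_frame n p u"
  shows "det (columns (u 1) (u 0)) = 1"
  using normalized_frameD(2)[OF assms, of 0] by (simp add: det_2 vec_det_eq algebra_simps)

section \<open>From lines to Stokes data and back\<close>

text \<open>
  The whole space and its levels are treated at once: \<open>Q = UNIV\<close> gives the whole space and \<open>Q = {q}\<close> a level.
\<close>

definition stokes_points :: "nat \<Rightarrow> complex set \<Rightarrow> (nat \<Rightarrow> complex^2^2) set" where
  "stokes_points k Q = {S \<in> stokes_data k. stokes_product S (2*k) \<in> torus \<and>
     stokes_product S (2*k) $ 2 $ 2 \<in> Q}"

definition sibuya_points :: "nat \<Rightarrow> complex set \<Rightarrow> (nat \<Rightarrow> (complex^2) set) set" where
  "sibuya_points k Q = {p \<in> sibuya_space k. multi_ratio k p \<in> Q}"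

definition stokes_lines :: "nat \<Rightarrow> (nat \<Rightarrow> complex^2^2) \<Rightarrow> nat \<Rightarrow> (complex^2) set" where
  "stokes_lines k S = (\<lambda>i\<in>{1..2*k}. vec.span {stokes_vector S i})"

lemma stokes_dataD:
  "S \<in> stokes_data k \<Longrightarrow> i \<in> {1..2*k} \<Longrightarrow>
    S i \<in> (if odd i then upper_unipotent else lower_unipotent)"
  unfolding stokes_data_def by (rule PiE_mem)

text \<open>
  The product of Stokes data is diagonal exactly when the last frame matrix, its inverse, is diagonal,
  and this says that the vectors with the indices \<open>2*k\<close> and \<open>2*k + 1\<close> return to the initial lines.
\<close>

lemma normalized_frame_stokes_lines:
  assumes k: "k \<ge> 1" and S: "S \<in> stokes_points k UNIV"
  shows "normalized_frame (2*k) (stokes_lines k S) (stokes_vector S)"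
proof -
  let ?V = "stokes_vector S" and ?F = "stokes_product S (2*k)"
  have F: "?F $ 1 $ 2 = 0" "?F $ 2 $ 1 = 0" "S \<in> stokes_data k"
    using S by (auto simp: stokes_points_def torus_def)
  have "frame_matrix ?V (2*k) ** ?F = mat 1"
    by (rule frame_matrix_stokes_product[OF stokes_dataD[OF F(3)]])
  then have "(columns (?V (Suc (2*k))) (?V (2*k)) ** ?F) $ i $ j = mat 1 $ i $ j" for i j
    by (simp add: frame_matrix_def)
  from this[of 1 1] this[of 1 2] this[of 2 1] this[of 2 2]
  have V: "?V (Suc (2*k)) $ 1 * ?F $ 1 $ 1 = 1" "?V (Suc (2*k)) $ 2 * ?F $ 1 $ 1 = 0"
    "?V (2*k) $ 1 * ?F $ 2 $ 2 = 0" "?V (2*k) $ 2 * ?F $ 2 $ 2 = 1"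
    by (simp_all add: mat2_mult_nth mat_1_nth F)
  have "?V (2*k) $ 2 \<noteq> 0" "?V (Suc (2*k)) $ 1 \<noteq> 0" using V(1,4) by auto
  moreover have "?V (2*k) = (?V (2*k) $ 2) *s ?V 0"
    "?V (Suc (2*k)) = (?V (Suc (2*k)) $ 1) *s ?V (Suc 0)"
    using V by (auto simp: vec2_eq_iff)
  ultimately have "vec.span {?V (2*k)} = vec.span {?V 0}"
    "vec.span {?V (Suc (2*k))} = vec.span {?V (Suc 0)}"
    by (metis span_scale_eq)+
  with k show ?thesis
    unfolding normalized_frame_def
    by (auto simp: vec_det_stokes_vector stokes_lines_def cyclic_index_def)
qed

lemma cyclic_next_eq_cyclic_index:
  "i \<in> {1..n} \<Longrightarrow> cyclic_next n i = cyclic_index n (Suc i)"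
  by (auto simp: cyclic_next_def cyclic_index_def)

lemma normalized_frame_imp_sibuya_space:
  assumes "p \<in> extensional {1..2*k}" and fr: "normalized_frame (2*k) p u"
  shows "p \<in> sibuya_space k"
proof -
  have p: "p i = vec.span {u i}" "u i \<noteq> 0" if "i \<in> {1..2*k}" for i
    using normalized_frame_spans[OF fr] that by (auto simp: spans_def)
  have "p i \<noteq> p (cyclic_next (2*k) i)" if i: "i \<in> {1..2*k}" for i
  proof
    assume eq: "p i = p (cyclic_next (2*k) i)"
    have "cyclic_next (2*k) i = cyclic_index (2*k) (Suc i)"
      by (rule cyclic_next_eq_cyclic_index[OF i])
    then have "vec.span {u (Suc i)} = vec.span {u i}"
      using normalized_frameD(1)[OF fr, of "Suc i"] i eq p(1)[OF i] by simp
    then obtain c where "u (Suc i) = c *s u i"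
      using normalized_frameD(3)[OF fr, of "Suc i"] i by (auto elim: span_eqD)
    then have "vec_det (u i) (u (Suc i)) = 0" by (simp add: vec_det_eq)
    with normalized_frameD(2)[OF fr, of i] i show False by simp
  qed
  moreover have "p i \<in> proj_line" if "i \<in> {1..2*k}" for i
    unfolding proj_line_def using p[OF that] by blast
  ultimately show ?thesis
    using assms(1) unfolding sibuya_space_def by (auto simp: PiE_def)
qed

text \<open>
  The factors that turn an arbitrary choice of spanning vectors \<open>w\<close> into a normalized frame; each
  determinant fixes the next factor, and the first one, \<open>c\<close>, is free.
\<close>

fun frame_scale :: "(nat \<Rightarrow> complex^2) \<Rightarrow> complex \<Rightarrow> nat \<Rightarrow> complex" where
  "frame_scale w c 0 = c"
| "frame_scale w c (Suc i) = (- 1) ^ Suc i / (frame_scale w c i * vec_det (w i) (w (Suc i)))"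

lemma frame_scale_nonzero:
  assumes "c \<noteq> 0" "\<And>j. j < i \<Longrightarrow> vec_det (w j) (w (Suc j)) \<noteq> 0"
  shows "frame_scale w c i \<noteq> 0"
  using assms by (induction i) auto

lemma sibuya_space_vec_det:
  assumes k: "k \<ge> 1" and p: "p \<in> sibuya_space k" and v: "spans (2*k) v p" and i: "i \<le> 2*k"
  shows "vec_det (v (cyclic_index (2*k) i)) (v (cyclic_index (2*k) (Suc i))) \<noteq> 0"
proof
  let ?c = "cyclic_index (2*k)"
  assume 0: "vec_det (v (?c i)) (v (?c (Suc i))) = 0"
  define j where "j = (if i = 0 then 2*k else i)"
  have j: "j \<in> {1..2*k}" "?c i = j" "?c (Suc i) = cyclic_next (2*k) j"
    using i k by (auto simp: j_def cyclic_index_def cyclic_next_def)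
  have "cyclic_next (2*k) j \<in> {1..2*k}" using k by (auto simp: cyclic_next_def Suc_le_eq)
  with 0 j v have "p j = p (cyclic_next (2*k) j)"
    using span_eq_if_vec_det_0 by (auto simp: spans_def)
  with p j(1) show False by (auto simp: sibuya_space_def)
qed

lemma normalized_frame_exists:
  assumes k: "k \<ge> 1" and p: "p \<in> sibuya_space k" and v: "spans (2*k) v p" and c: "c \<noteq> 0"
  defines "w \<equiv> \<lambda>i. v (cyclic_index (2*k) i)"
  shows "normalized_frame (2*k) p (\<lambda>i. frame_scale w c i *s w i)"
proof -
  have det: "vec_det (w i) (w (Suc i)) \<noteq> 0" if "i \<le> 2*k" for i
    unfolding w_def by (rule sibuya_space_vec_det[OF k p v that])
  have scale: "frame_scale w c i \<noteq> 0" if "i \<le> Suc (2*k)" for i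
    using that c det by (intro frame_scale_nonzero) auto
  have "p (cyclic_index (2*k) i) = vec.span {w i}" if "i \<le> Suc (2*k)" for i
  proof -
    have "cyclic_index (2*k) i \<in> {1..2*k}" using that k by (auto simp: cyclic_index_def)
    with v show ?thesis by (auto simp: spans_def w_def)
  qed
  moreover have "vec_det (frame_scale w c i *s w i) (frame_scale w c (Suc i) *s w (Suc i)) =
      (- 1) ^ Suc i" if "i \<le> 2*k" for i
    unfolding vec_det_scale using scale[of i] det[OF that] that by simp
  ultimately show ?thesis
    using scale unfolding normalized_frame_def by (simp add: span_scale_eq)
qed

text \<open>
  In a normalized frame all determinants in the multi-ratio are \<open>1\<close> or \<open>-1\<close> except the one that closes
  the cycle, which is \<open>- b\<close> where \<open>u (2*k) = b *s u 0\<close>. The last frame matrix, which is inverse to the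
  Stokes product, has the lower right entry \<open>b\<close>. So both the multi-ratio and the lower right entry of the
  Stokes product are \<open>1 / b\<close>.
\<close>

lemma normalized_frame_stokes_of:
  assumes k: "k \<ge> 1" and fr: "normalized_frame (2*k) p u"
  shows "stokes_of (2*k) u \<in> stokes_points k {multi_ratio k p}"
proof -
  let ?S = "stokes_of (2*k) u"
  let ?V = "stokes_vector ?S" and ?F = "stokes_product ?S (2*k)" and ?A = "columns (u 1) (u 0)"
  have u: "u i = ?A *v ?V i" if "i \<le> Suc (2*k)" for i
    by (rule normalized_frame_eq_image[OF fr that])
  have inj: "x = y" if "?A *v x = ?A *v y" for x y
  proof -
    have "invertible ?A" using det_frame[OF fr] by (simp add: invertible_det_nz)
    then obtain B where "B ** ?A = mat 1" unfolding invertible_def by blast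
    then have "y = B *v (?A *v y)" for y by (simp add: matrix_vector_mul_assoc)
    with that show ?thesis by metis
  qed
  have mul: "?A *v (c *s x) = c *s (?A *v x)" for c x
    by (simp add: vec2_eq_iff mat2_vector_nth algebra_simps)
  have ci: "cyclic_index (2*k) 0 = cyclic_index (2*k) (2*k)"
    "cyclic_index (2*k) (Suc 0) = cyclic_index (2*k) (Suc (2*k))"
    using k by (auto simp: cyclic_index_def)
  obtain b where b: "b \<noteq> 0" "u (2*k) = b *s u 0"
    using normalized_frameD(1,3)[OF fr, of "2*k"] normalized_frameD(1)[OF fr, of 0] ci
    by (auto elim: span_eqD[of "u (2*k)" "u 0"])
  obtain a where a: "a \<noteq> 0" "u (Suc (2*k)) = a *s u (Suc 0)"
    using normalized_frameD(1,3)[OF fr, of "Suc (2*k)"] normalized_frameD(1)[OF fr, of "Suc 0"] ci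
    by (auto elim: span_eqD[of "u (Suc (2*k))" "u (Suc 0)"])
  have image: "?A *v ?V i = u i" if "i \<le> Suc (2*k)" for i by (rule u[OF that, symmetric])
  have "?V (2*k) = b *s ?V 0"
    by (rule inj) (simp only: mul image b(2) le0 le_SucI order_refl)
  moreover have "?V (Suc (2*k)) = a *s ?V (Suc 0)"
    by (rule inj) (simp only: mul image a(2) le0 Suc_le_mono order_refl)
  ultimately have fm: "frame_matrix ?V (2*k) = diag2 a b"
    by (simp add: frame_matrix_def diag2_def vec2_eq_iff)
  have "frame_matrix ?V (2*k) ** ?F = mat 1"
    by (rule frame_matrix_stokes_product[OF stokes_dataD[OF stokes_of_in_stokes_data]])
  then have inv: "?F ** diag2 a b = mat 1" and F: "diag2 a b ** ?F = mat 1"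
    using matrix_left_right_inverse[of "diag2 a b" ?F] by (simp_all add: fm)
  have "(diag2 a b ** ?F) $ i $ j = mat 1 $ i $ j" for i j by (simp add: F)
  from this[of 1 2] this[of 2 1] this[of 2 2]
  have Fe: "?F $ 1 $ 2 = 0" "?F $ 2 $ 1 = 0" "b * ?F $ 2 $ 2 = 1"
    using a b by (simp_all add: mat2_mult_nth mat_1_nth diag2_def)
  have "invertible ?F" using inv F unfolding invertible_def by blast
  with Fe have "?F \<in> torus" by (simp add: torus_def)
  have "multi_ratio k p = vec_multi_ratio k u"
    by (rule multi_ratio_eq[OF normalized_frame_spans[OF fr]])
  also have "\<dots> = 1 / b"
  proof -
    have "vec_det (u (2*i - 1)) (u (2*i)) = 1" if "i \<in> {1..k}" for i
      using normalized_frameD(2)[OF fr, of "2*i-1"] that by auto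
    then have 1: "(\<Prod>i=1..k. vec_det (u (2*i - 1)) (u (2*i))) = 1" by simp
    obtain m where m: "k = Suc m" using k by (cases k) auto
    have "vec_det (u (2*i)) (u (cyclic_next (2*k) (2*i))) = -1" if "i \<in> {1..m}" for i
    proof -
      have "cyclic_next (2*k) (2*i) = Suc (2*i)" using that by (auto simp: cyclic_next_def m)
      with normalized_frameD(2)[OF fr, of "2*i"] that show ?thesis by (simp add: m)
    qed
    then have "(\<Prod>i=1..m. vec_det (u (2*i)) (u (cyclic_next (2*k) (2*i)))) = (-1)^m" by simp
    moreover have "vec_det (u (2*k)) (u (cyclic_next (2*k) (2*k))) = - b"
      using normalized_frameD(2)[OF fr, of 0] vec_det_scale[of b "u 0" 1 "u 1"]
      by (simp add: b(2) cyclic_next_def)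
    ultimately have 2: "(\<Prod>i=1..k. vec_det (u (2*i)) (u (cyclic_next (2*k) (2*i)))) = (-1)^k * b"
      unfolding m by simp
    show ?thesis unfolding vec_multi_ratio_def 1 2 by simp
  qed
  finally have "?F $ 2 $ 2 = multi_ratio k p" using Fe(3) b(1)
    by (metis nonzero_eq_divide_eq mult.commute)
  with \<open>?F \<in> torus\<close> show ?thesis
    using stokes_of_in_stokes_data by (simp add: stokes_points_def)
qed

lemma stokes_of_stokes_vector:
  assumes S: "S \<in> stokes_data k"
  shows "stokes_of (2*k) (stokes_vector S) = S"
proof
  fix i
  show "stokes_of (2*k) (stokes_vector S) i = S i"
  proof (cases "i \<in> {1..2*k}")
    case True
    then obtain m where m: "i = Suc m" by (cases i) auto
    have "vec_det v (v - a *s w) = - a * vec_det v w" for v w a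
      by (simp add: vec_det_eq algebra_simps)
    then have "(- 1) ^ i * vec_det (stokes_vector S m) (stokes_vector S (Suc i)) * (-1) =
        stokes_entry i (S i)"
      by (simp add: m vec_det_stokes_vector)
    then show ?thesis
      using True unipotent_stokes_entry[OF stokes_dataD[OF S True]]
      by (simp add: stokes_of_def m)
  next
    case False
    then show ?thesis
      using S by (auto simp: stokes_of_def stokes_data_def PiE_def extensional_def)
  qed
qed

lemma stokes_points_mono: "Q \<subseteq> Q' \<Longrightarrow> stokes_points k Q \<subseteq> stokes_points k Q'"
  by (auto simp: stokes_points_def)

lemma multi_ratio_stokes_lines:
  assumes "k \<ge> 1" "S \<in> stokes_points k Q"
  shows "multi_ratio k (stokes_lines k S) = stokes_product S (2*k) $ 2 $ 2"
proof -
  have S: "S \<in> stokes_points k UNIV" using assms(2) by (auto simp: stokes_points_def)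
  have "S \<in> stokes_points k {multi_ratio k (stokes_lines k S)}"
    using normalized_frame_stokes_of[OF assms(1) normalized_frame_stokes_lines[OF assms(1) S]]
      stokes_of_stokes_vector[of S k] S by (simp add: stokes_points_def)
  then show ?thesis by (simp add: stokes_points_def)
qed

lemma stokes_lines_in_sibuya_points:
  assumes "k \<ge> 1" "S \<in> stokes_points k Q"
  shows "stokes_lines k S \<in> sibuya_points k Q"
proof -
  have S: "S \<in> stokes_points k UNIV" using assms(2) by (auto simp: stokes_points_def)
  have "stokes_lines k S \<in> sibuya_space k"
    by (rule normalized_frame_imp_sibuya_space[OF _ normalized_frame_stokes_lines[OF assms(1) S]])
      (simp add: stokes_lines_def)
  then show ?thesis
    using assms multi_ratio_stokes_lines[OF assms]
    by (simp add: sibuya_points_def stokes_points_def)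
qed

section \<open>Orbits of the torus and of the projective group\<close>

text \<open>
  Conjugation of all matrices by \<open>diag(\<kappa>, 1)\<close>. Scalar matrices act trivially, so these conjugations
  give the whole action of the torus.
\<close>

definition twist :: "nat \<Rightarrow> complex \<Rightarrow> (nat \<Rightarrow> complex^2^2) \<Rightarrow> nat \<Rightarrow> complex^2^2" where
  "twist n \<kappa> S = (\<lambda>i\<in>{1..n}.
     vector [vector [S i $ 1 $ 1, \<kappa> * S i $ 1 $ 2], vector [S i $ 2 $ 1 / \<kappa>, S i $ 2 $ 2]])"

lemma twist_nth:
  assumes "i \<in> {1..n}"
  shows "twist n \<kappa> S i $ 1 $ 1 = S i $ 1 $ 1" "twist n \<kappa> S i $ 1 $ 2 = \<kappa> * S i $ 1 $ 2"
    "twist n \<kappa> S i $ 2 $ 1 = S i $ 2 $ 1 / \<kappa>" "twist n \<kappa> S i $ 2 $ 2 = S i $ 2 $ 2"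
  using assms by (simp_all add: twist_def)

lemma twist_twist: "twist n \<kappa> (twist n \<mu> S) = twist n (\<kappa> * \<mu>) S"
  by (rule ext) (simp add: twist_def vec2_eq_iff)

lemma matrix_inv_diagonal:
  assumes "h \<in> torus"
  shows "h $ 1 $ 1 \<noteq> 0" "h $ 2 $ 2 \<noteq> 0"
    "matrix_inv h = diag2 (inverse (h $ 1 $ 1)) (inverse (h $ 2 $ 2))"
proof -
  have h: "h $ 1 $ 2 = 0" "h $ 2 $ 1 = 0" "det h \<noteq> 0"
    using assms by (auto simp: torus_def invertible_det_nz)
  then show nz: "h $ 1 $ 1 \<noteq> 0" "h $ 2 $ 2 \<noteq> 0" by (auto simp: det_2)
  have right: "h ** diag2 (inverse (h $ 1 $ 1)) (inverse (h $ 2 $ 2)) = mat 1"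
    using h nz by (simp add: vec2_eq_iff mat2_mult_nth mat_1_nth diag2_def)
  have "h ** matrix_inv h = mat 1 \<and> matrix_inv h ** h = mat 1"
    unfolding matrix_inv_def
    by (rule someI_ex) (use assms in \<open>simp add: torus_def invertible_def\<close>)
  then have "matrix_inv h ** (h ** diag2 (inverse (h $ 1 $ 1)) (inverse (h $ 2 $ 2))) =
      diag2 (inverse (h $ 1 $ 1)) (inverse (h $ 2 $ 2))"
    by (simp add: matrix_mul_assoc)
  then show "matrix_inv h = diag2 (inverse (h $ 1 $ 1)) (inverse (h $ 2 $ 2))"
    by (simp add: right)
qed

lemma torus_action_eq: "torus_action n = {twist n \<kappa> | \<kappa>. \<kappa> \<noteq> 0}"
proof -
  have eq: "(\<lambda>S. \<lambda>i\<in>{1..n}. h ** S i ** matrix_inv h) = twist n (h $ 1 $ 1 / h $ 2 $ 2)"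
    if h: "h \<in> torus" for h
  proof (intro ext)
    fix S :: "nat \<Rightarrow> complex^2^2" and i
    have "h $ 1 $ 2 = 0" "h $ 2 $ 1 = 0" using h by (auto simp: torus_def)
    then have "h ** S i ** matrix_inv h = vector [vector [S i $ 1 $ 1, h $ 1 $ 1 / h $ 2 $ 2 * S i $ 1 $ 2],
        vector [S i $ 2 $ 1 / (h $ 1 $ 1 / h $ 2 $ 2), S i $ 2 $ 2]]"
      using matrix_inv_diagonal(1,2)[OF h]
      by (simp add: vec2_eq_iff mat2_mult_nth matrix_inv_diagonal(3)[OF h] diag2_def field_simps)
    then show "(\<lambda>i\<in>{1..n}. h ** S i ** matrix_inv h) i = twist n (h $ 1 $ 1 / h $ 2 $ 2) S i"
      by (simp add: twist_def)
  qed
  have "diag2 \<kappa> 1 \<in> torus" if "\<kappa> \<noteq> 0" for \<kappa>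
    using that by (simp add: torus_def diag2_def invertible_det_nz det_2)
  moreover have "diag2 \<kappa> 1 $ 1 $ 1 / diag2 \<kappa> 1 $ 2 $ 2 = \<kappa>" for \<kappa>
    by (simp add: diag2_def)
  ultimately have "\<exists>h. h \<in> torus \<and> twist n \<kappa> = (\<lambda>S. \<lambda>i\<in>{1..n}. h ** S i ** matrix_inv h)"
    if "\<kappa> \<noteq> 0" for \<kappa>
    using eq[of "diag2 \<kappa> 1"] that by (intro exI[of _ "diag2 \<kappa> 1"]) simp
  moreover have "h $ 1 $ 1 / h $ 2 $ 2 \<noteq> 0" if "h \<in> torus" for h
    using matrix_inv_diagonal[OF that] by simp
  ultimately show ?thesis
    unfolding torus_action_def using eq by (intro equalityI subsetI) (force+)
qed

lemma stokes_product_twist: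
  fixes S :: "nat \<Rightarrow> complex^2^2"
  assumes "\<kappa> \<noteq> 0" "m \<le> n"
  defines "A \<equiv> stokes_product S m" and "B \<equiv> stokes_product (twist n \<kappa> S) m"
  shows "B $ 1 $ 1 = A $ 1 $ 1" "B $ 1 $ 2 = \<kappa> * A $ 1 $ 2"
    "B $ 2 $ 1 = A $ 2 $ 1 / \<kappa>" "B $ 2 $ 2 = A $ 2 $ 2"
proof -
  have "B $ 1 $ 1 = A $ 1 $ 1 \<and> B $ 1 $ 2 = \<kappa> * A $ 1 $ 2 \<and>
    B $ 2 $ 1 = A $ 2 $ 1 / \<kappa> \<and> B $ 2 $ 2 = A $ 2 $ 2"
    using assms(2) unfolding A_def B_def
  proof (induction m)
    case 0
    show ?case by (simp add: mat_1_nth)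
  next
    case (Suc m)
    then show ?case using assms(1) by (simp add: mat2_mult_nth twist_nth field_simps)
  qed
  then show "B $ 1 $ 1 = A $ 1 $ 1" "B $ 1 $ 2 = \<kappa> * A $ 1 $ 2"
    "B $ 2 $ 1 = A $ 2 $ 1 / \<kappa>" "B $ 2 $ 2 = A $ 2 $ 2" by auto
qed

lemma twist_in_stokes_points:
  assumes "\<kappa> \<noteq> 0" "S \<in> stokes_points k Q"
  shows "twist (2*k) \<kappa> S \<in> stokes_points k Q"
proof -
  have S: "S \<in> stokes_data k" using assms(2) by (simp add: stokes_points_def)
  have "twist (2*k) \<kappa> S i \<in> (if odd i then upper_unipotent else lower_unipotent)"
    if "i \<in> {1..2*k}" for i
    using stokes_dataD[OF S that] twist_nth[OF that, of \<kappa> S]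
    by (auto simp: upper_unipotent_def lower_unipotent_def split: if_splits)
  then have "twist (2*k) \<kappa> S \<in> stokes_data k"
    unfolding stokes_data_def by (intro PiE_I) (auto simp: twist_def)
  with assms stokes_product_twist[OF assms(1) order_refl, of "2*k" S] show ?thesis
    by (auto simp: stokes_points_def torus_def invertible_det_nz det_2)
qed

text \<open>
  The only freedom in a normalized frame is a factor at the even indices and its inverse at the odd
  ones; on the Stokes data it acts through the torus.
\<close>

lemma normalized_frame_rescale:
  assumes fr: "normalized_frame n p u" and m: "\<mu> \<noteq> 0"
  defines "u' \<equiv> \<lambda>i. (if even i then \<mu> else inverse \<mu>) *s u i"
  shows "normalized_frame n p u'" "stokes_of n u' = twist n (\<mu>\<^sup>2) (stokes_of n u)"
proof -
  show "normalized_frame n p u'"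
    using fr m unfolding normalized_frame_def u'_def vec_det_scale
    by (auto simp: span_scale_eq)
  show "stokes_of n u' = twist n (\<mu>\<^sup>2) (stokes_of n u)"
  proof (rule ext)
    fix i
    show "stokes_of n u' i = twist n (\<mu>\<^sup>2) (stokes_of n u) i"
    proof (cases "i \<in> {1..n}")
      case True
      then have "odd (i - 1) \<longleftrightarrow> even i" by (cases i) auto
      with True show ?thesis
        unfolding u'_def stokes_of_def twist_def vec_det_scale
        by (cases "even i") (simp_all add: unipotent_def vec2_eq_iff power2_eq_square field_simps)
    next
      case False
      then show ?thesis by (simp only: stokes_of_def twist_def restrict_apply if_False)
    qed
  qed
qed

lemma normalized_frames_proportional:
  assumes fr: "normalized_frame n p u" "normalized_frame n p u'"
  obtains \<mu> where "\<mu> \<noteq> 0"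
    "\<And>i. i \<le> Suc n \<Longrightarrow> u' i = (if even i then \<mu> else inverse \<mu>) *s u i"
proof -
  have scalar: "\<exists>c. c \<noteq> 0 \<and> u' i = c *s u i" if "i \<le> Suc n" for i
  proof -
    have "vec.span {u' i} = vec.span {u i}" "u' i \<noteq> 0"
      using normalized_frameD(1)[OF fr(1) that] normalized_frameD(1,3)[OF fr(2) that] by auto
    then show ?thesis by (auto elim: span_eqD)
  qed
  obtain \<mu> where \<mu>: "\<mu> \<noteq> 0" "u' 0 = \<mu> *s u 0" using scalar[of 0] by auto
  have "u' i = (if even i then \<mu> else inverse \<mu>) *s u i" if "i \<le> Suc n" for i
    using that
  proof (induction i)
    case (Suc i)
    let ?d = "if even i then \<mu> else inverse \<mu>"
    obtain c where c: "u' (Suc i) = c *s u (Suc i)" using scalar Suc.prems by auto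
    have "vec_det (u' i) (u' (Suc i)) = ?d * c * vec_det (u i) (u (Suc i))"
      using Suc by (simp only: c vec_det_scale)
    then have "?d * c = 1"
      using Suc.prems normalized_frameD(2)[OF fr(1), of i] normalized_frameD(2)[OF fr(2), of i]
      by auto
    then have "c = inverse ?d" using inverse_unique by metis
    with c show ?case by auto
  qed (simp add: \<mu>)
  with \<mu>(1) that show thesis by blast
qed

lemma stokes_of_frames_eq_twist:
  assumes fr: "normalized_frame n p u" "normalized_frame n p u'"
  obtains \<kappa> where "\<kappa> \<noteq> 0" "stokes_of n u' = twist n \<kappa> (stokes_of n u)"
proof -
  obtain \<mu> where \<mu>: "\<mu> \<noteq> 0"
    "\<And>i. i \<le> Suc n \<Longrightarrow> u' i = (if even i then \<mu> else inverse \<mu>) *s u i"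
    using normalized_frames_proportional[OF fr] by metis
  have "stokes_of n u' = stokes_of n (\<lambda>i. (if even i then \<mu> else inverse \<mu>) *s u i)"
    unfolding stokes_of_def
  proof (rule restrict_ext)
    fix i assume "i \<in> {1..n}"
    then show "unipotent i ((- 1) ^ Suc i * vec_det (u' (i - 1)) (u' (Suc i))) =
        unipotent i ((- 1) ^ Suc i *
          vec_det ((if even (i - 1) then \<mu> else inverse \<mu>) *s u (i - 1))
            ((if even (Suc i) then \<mu> else inverse \<mu>) *s u (Suc i)))"
      using \<mu>(2)[of "i - 1"] \<mu>(2)[of "Suc i"] by auto
  qed
  with normalized_frame_rescale(2)[OF fr(1) \<mu>(1)] \<mu>(1) that[of "\<mu>\<^sup>2"] show thesis by simp
qed

lemma normalized_frame_image:
  assumes k: "k \<ge> 1" and fr: "normalized_frame (2*k) p u" and A: "det A = 1"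
  shows "normalized_frame (2*k) (\<lambda>i\<in>{1..2*k}. (\<lambda>x. A *v x) ` p i) (\<lambda>i. A *v u i)"
    "stokes_of (2*k) (\<lambda>i. A *v u i) = stokes_of (2*k) u"
proof -
  have "cyclic_index (2*k) i \<in> {1..2*k}" if "i \<le> Suc (2*k)" for i
    using that k by (auto simp: cyclic_index_def)
  with fr show "normalized_frame (2*k) (\<lambda>i\<in>{1..2*k}. (\<lambda>x. A *v x) ` p i) (\<lambda>i. A *v u i)"
    by (simp add: normalized_frame_def vec_det_mat_vector A image_span_singleton)
  show "stokes_of (2*k) (\<lambda>i. A *v u i) = stokes_of (2*k) u"
    by (simp add: stokes_of_def vec_det_mat_vector A)
qed

text \<open>
  The lines of the Stokes data of \<open>p\<close> are those of \<open>p\<close> moved by the inverse of the matrix with columns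
  \<open>u 1\<close> and \<open>u 0\<close>, which has determinant 1.
\<close>

lemma normalized_frame_orbit:
  assumes p: "p \<in> extensional {1..2*k}" and fr: "normalized_frame (2*k) p u"
  shows "\<exists>g\<in>psl2_action (2*k). p = g (stokes_lines k (stokes_of (2*k) u))"
proof -
  let ?A = "columns (u 1) (u 0)" and ?S = "stokes_of (2*k) u"
  have "p = (\<lambda>i\<in>{1..2*k}. (\<lambda>x. ?A *v x) ` stokes_lines k ?S i)"
  proof
    fix i
    show "p i = (\<lambda>i\<in>{1..2*k}. (\<lambda>x. ?A *v x) ` stokes_lines k ?S i) i"
    proof (cases "i \<in> {1..2*k}")
      case True
      then have "p i = vec.span {u i}" using normalized_frame_spans[OF fr] by (simp add: spans_def)
      with True show ?thesis
        using normalized_frame_eq_image[OF fr, of i] by (simp add: stokes_lines_def image_span_singleton)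
    next
      case False
      then show ?thesis using p by (auto simp: extensional_def)
    qed
  qed
  then show ?thesis
    unfolding psl2_action_def using det_frame[OF fr]
    by (intro bexI[of _ "\<lambda>p. \<lambda>i\<in>{1..2*k}. (\<lambda>x. ?A *v x) ` p i"]) auto
qed

lemma psl2_action_frame:
  assumes k: "k \<ge> 1" and p: "p \<in> sibuya_points k Q" and g: "g \<in> psl2_action (2*k)"
    and fr: "normalized_frame (2*k) p u"
  obtains u' where "normalized_frame (2*k) (g p) u'" "stokes_of (2*k) u' = stokes_of (2*k) u"
    "g p \<in> sibuya_points k Q"
proof -
  obtain A where A: "det A = 1" "g = (\<lambda>p. \<lambda>i\<in>{1..2*k}. (\<lambda>x. A *v x) ` p i)"
    using g by (auto simp: psl2_action_def)
  note fr' = normalized_frame_image[OF k fr A(1)]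
  have fr'': "normalized_frame (2*k) (g p) (\<lambda>i. A *v u i)" using fr'(1) by (simp add: A(2))
  have "g p \<in> sibuya_space k"
    by (rule normalized_frame_imp_sibuya_space[OF _ fr'']) (simp add: A(2))
  moreover have "multi_ratio k (g p) = multi_ratio k p"
    using normalized_frame_stokes_of[OF k fr''] normalized_frame_stokes_of[OF k fr] fr'(2)
    by (simp add: stokes_points_def)
  ultimately have "g p \<in> sibuya_points k Q" using p by (simp add: sibuya_points_def)
  with fr'' fr'(2) show thesis by (rule that)
qed

text \<open>
  The choice of the frame matters only up to the torus action.
\<close>

definition stokes_of_lines :: "nat \<Rightarrow> (nat \<Rightarrow> (complex^2) set) \<Rightarrow> nat \<Rightarrow> complex^2^2" where
  "stokes_of_lines k p = stokes_of (2*k) (SOME u. normalized_frame (2*k) p u)"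

lemma sibuya_points_frame_ex:
  assumes k: "k \<ge> 1" and p: "p \<in> sibuya_points k Q"
  shows "\<exists>u. normalized_frame (2*k) p u"
proof -
  have pX: "p \<in> sibuya_space k" using p by (simp add: sibuya_points_def)
  then have "\<forall>i\<in>{1..2*k}. \<exists>v. v \<noteq> 0 \<and> p i = vec.span {v}"
    by (auto simp: sibuya_space_def proj_line_def dest: PiE_mem)
  then obtain v where "spans (2*k) v p" unfolding spans_def by metis
  from normalized_frame_exists[OF k pX this, of 1] show ?thesis by auto
qed

lemma stokes_of_lines_frame:
  assumes k: "k \<ge> 1" and p: "p \<in> sibuya_points k Q"
  obtains u where "normalized_frame (2*k) p u" "stokes_of_lines k p = stokes_of (2*k) u"
  using someI_ex[OF sibuya_points_frame_ex[OF assms]] that unfolding stokes_of_lines_def by blast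

lemma stokes_of_lines_in_stokes_points:
  assumes k: "k \<ge> 1" and p: "p \<in> sibuya_points k Q"
  shows "stokes_of_lines k p \<in> stokes_points k Q"
proof -
  obtain u where "normalized_frame (2*k) p u" "stokes_of_lines k p = stokes_of (2*k) u"
    by (rule stokes_of_lines_frame[OF assms])
  with normalized_frame_stokes_of[OF k this(1)] p show ?thesis
    by (auto simp: stokes_points_def sibuya_points_def)
qed

lemma twist_invariant_stokes_of:
  assumes b: "\<And>\<kappa> S. \<kappa> \<noteq> 0 \<Longrightarrow> S \<in> stokes_points k Q \<Longrightarrow> b (twist (2*k) \<kappa> S) = b S"
    and k: "k \<ge> 1" and p: "p \<in> sibuya_points k Q"
    and fr: "normalized_frame (2*k) p u"
  shows "b (stokes_of_lines k p) = b (stokes_of (2*k) u)"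
proof -
  obtain u' where u': "normalized_frame (2*k) p u'" "stokes_of_lines k p = stokes_of (2*k) u'"
    by (rule stokes_of_lines_frame[OF k p])
  obtain \<kappa> where l: "\<kappa> \<noteq> 0" "stokes_of (2*k) u' = twist (2*k) \<kappa> (stokes_of (2*k) u)"
    by (rule stokes_of_frames_eq_twist[OF fr u'(1)])
  have "stokes_of (2*k) u \<in> stokes_points k Q"
    using normalized_frame_stokes_of[OF k fr] p by (auto simp: stokes_points_def sibuya_points_def)
  with l u'(2) b show ?thesis by simp
qed

section \<open>Polynomials on the Stokes data\<close>

definition matrix_entries :: "nat \<Rightarrow> ((nat \<Rightarrow> complex^2^2) \<Rightarrow> complex) set" where
  "matrix_entries n = {(\<lambda>S. S i $ a $ b) | i a b. i \<in> {1..n}}"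

abbreviation matrix_polynomials :: "nat \<Rightarrow> ((nat \<Rightarrow> complex^2^2) \<Rightarrow> complex) set" where
  "matrix_polynomials n \<equiv> polynomials_in (matrix_entries n)"

lemma matrix_entry_polynomial:
  "i \<in> {1..n} \<Longrightarrow> (\<lambda>S. S i $ a $ b) \<in> matrix_polynomials n"
  by (rule polynomials_in.gen) (auto simp: matrix_entries_def)

lemma stokes_product_polynomial:
  "m \<le> n \<Longrightarrow> (\<lambda>S. stokes_product S m $ a $ b) \<in> matrix_polynomials n"
proof (induction m arbitrary: a b)
  case 0
  show ?case by (simp add: polynomials_in.const)
next
  case (Suc m)
  then show ?case
    by (simp add: mat2_mult_nth)
      (intro polynomials_in.add polynomials_in.mult matrix_entry_polynomial; simp)
qed

lemma stokes_vector_polynomial: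
  "i \<le> Suc n \<Longrightarrow> (\<lambda>S. stokes_vector S i $ a) \<in> matrix_polynomials n"
proof (induction i rule: less_induct)
  case (less i)
  consider "i = 0" | "i = 1" | m where "i = Suc (Suc m)" by (metis One_nat_def old.nat.exhaust)
  then show ?case
  proof cases
    case (3 m)
    have 1: "(\<lambda>S. stokes_vector S m $ a) \<in> matrix_polynomials n"
      by (rule less.IH) (use less.prems 3 in simp_all)
    have 2: "(\<lambda>S. stokes_vector S (Suc m) $ a) \<in> matrix_polynomials n"
      by (rule less.IH) (use less.prems 3 in simp_all)
    have 3: "(\<lambda>S. stokes_entry (Suc m) (S (Suc m))) \<in> matrix_polynomials n"
      unfolding stokes_entry_def
      by (cases "odd (Suc m)") (use less.prems 3 in \<open>auto intro!: matrix_entry_polynomial\<close>)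
    show ?thesis
      using polynomials_in_diff[OF 1 polynomials_in.mult[OF 3 2]] \<open>i = _\<close> by simp
  qed (simp_all add: polynomials_in.const)
qed

lemma matrix_polynomials_cong:
  assumes "f \<in> matrix_polynomials n" "\<And>i. i \<in> {1..n} \<Longrightarrow> S i = S' i"
  shows "f S = f S'"
  using assms(1) by (rule polynomials_in_cong) (auto simp: assms(2) matrix_entries_def)

text \<open>
  The two cases that occur; in both the level is cut out by polynomial equations.
\<close>

definition closed_values :: "complex set \<Rightarrow> bool" where
  "closed_values Q \<longleftrightarrow> Q = UNIV \<or> (\<exists>q. Q = {q})"

lemma det_stokes_product:
  assumes "S \<in> stokes_data k" "m \<le> 2*k"
  shows "det (stokes_product S m) = 1"
  using assms(2)
proof (induction m)
  case (Suc m)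
  have "det (S (Suc m)) = 1"
    using stokes_dataD[OF assms(1), of "Suc m"] Suc.prems
    by (auto simp: det_2 upper_unipotent_def lower_unipotent_def split: if_splits)
  with Suc show ?case by (simp add: det_mul)
qed simp

lemma stokes_product_cong:
  "(\<And>i. i \<in> {1..m} \<Longrightarrow> S i = S' i) \<Longrightarrow> stokes_product S m = stokes_product S' m"
  by (induction m) auto

text \<open>
  The Stokes data form a Zariski closed set. Invertibility of the product is automatic, since its
  determinant is 1, so all the defining conditions are equations. A common zero of the vanishing
  polynomials satisfies them; its values outside \<open>{1..2*k}\<close>, which the polynomials do not see, are made
  undefined by the restriction.
\<close>

lemma common_zero_in_stokes_points:
  assumes Q: "closed_values Q"
    and zero: "\<And>f. f \<in> matrix_polynomials (2*k) \<Longrightarrow> (\<forall>S\<in>stokes_points k Q. f S = 0) \<Longrightarrow> f s = 0"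
  shows "restrict s {1..2*k} \<in> stokes_points k Q"
proof -
  let ?P = "matrix_polynomials (2*k)" and ?F = "stokes_product s (2*k)"
  have zero': "f s = c" if "f \<in> ?P" "\<And>S. S \<in> stokes_points k Q \<Longrightarrow> f S = c" for f c
    using zero[OF polynomials_in_diff[OF that(1) polynomials_in.const[of c]]] that(2) by simp
  have entry: "s i $ a $ b = c"
    if "i \<in> {1..2*k}" "\<And>S. S \<in> stokes_points k Q \<Longrightarrow> S i $ a $ b = c" for i a b c
    by (rule zero'[of "\<lambda>S. S i $ a $ b"]) (use that in \<open>auto intro: matrix_entry_polynomial\<close>)
  have "s i \<in> (if odd i then upper_unipotent else lower_unipotent)" if i: "i \<in> {1..2*k}" for i
  proof -
    have S: "S i \<in> (if odd i then upper_unipotent else lower_unipotent)"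
      if "S \<in> stokes_points k Q" for S
      using that i by (intro stokes_dataD[of S k]) (auto simp: stokes_points_def)
    have "s i $ 1 $ 1 = 1" "s i $ 2 $ 2 = 1"
      by (rule entry[OF i], use S in \<open>force simp: upper_unipotent_def lower_unipotent_def
            split: if_splits\<close>)+
    moreover have "s i $ 2 $ 1 = 0" if "odd i"
      by (rule entry[OF i]) (use S that in \<open>force simp: upper_unipotent_def\<close>)
    moreover have "s i $ 1 $ 2 = 0" if "even i"
      by (rule entry[OF i]) (use S that in \<open>force simp: lower_unipotent_def\<close>)
    ultimately show ?thesis by (simp add: upper_unipotent_def lower_unipotent_def)
  qed
  then have data: "restrict s {1..2*k} \<in> stokes_data k"
    unfolding stokes_data_def by (intro PiE_I) auto
  have eq: "stokes_product (restrict s {1..2*k}) (2*k) = ?F"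
    by (rule stokes_product_cong) simp
  have F: "?F $ a $ b = c" if "\<And>S. S \<in> stokes_points k Q \<Longrightarrow> stokes_product S (2*k) $ a $ b = c"
    for a b c
    by (rule zero'[OF stokes_product_polynomial[OF order_refl] that])
  have "?F $ 1 $ 2 = 0" "?F $ 2 $ 1 = 0"
    by (rule F, simp add: stokes_points_def torus_def)+
  moreover have "invertible ?F"
    using det_stokes_product[OF data order_refl] unfolding eq by (simp add: invertible_det_nz)
  moreover have "?F $ 2 $ 2 \<in> Q"
    using Q unfolding closed_values_def
  proof
    assume "\<exists>q. Q = {q}"
    then obtain q where q: "Q = {q}" by blast
    have "?F $ 2 $ 2 = q" by (rule F) (simp add: stokes_points_def q)
    then show ?thesis by (simp add: q)
  qed simp
  ultimately show ?thesis using data unfolding stokes_points_def torus_def eq[symmetric] by simp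
qed

lemma nullstellensatz_stokes_points:
  assumes Q: "closed_values Q"
    and J: "function_ideal (matrix_entries (2*k)) J" "(\<lambda>_. 1) \<notin> J"
    and sub: "\<And>f. f \<in> matrix_polynomials (2*k) \<Longrightarrow> (\<forall>S\<in>stokes_points k Q. f S = 0) \<Longrightarrow> f \<in> J"
  shows "\<exists>S\<in>stokes_points k Q. \<forall>f\<in>J. f S = 0"
proof -
  let ?B = "matrix_entries (2*k)"
  have "?B = (\<Union>i\<in>{1..2*k}. \<Union>a. \<Union>b. {\<lambda>S. S i $ a $ b})"
    unfolding matrix_entries_def by blast
  then have "countable ?B" by (simp add: countable_finite)
  moreover have "\<exists>s. \<forall>b\<in>?B. b s = c b" for c
    by (intro exI[of _ "\<lambda>i. \<chi> a b. c (\<lambda>S. S i $ a $ b)"]) (auto simp: matrix_entries_def)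
  ultimately obtain s where s: "\<forall>f\<in>J. f s = 0" using nullstellensatz[of ?B J] J by auto
  have "restrict s {1..2*k} \<in> stokes_points k Q"
    by (rule common_zero_in_stokes_points[OF Q]) (use s sub in auto)
  moreover have "f (restrict s {1..2*k}) = 0" if "f \<in> J" for f
  proof -
    have "f \<in> matrix_polynomials (2*k)" using function_idealD(1)[OF J(1)] that by blast
    then have "f (restrict s {1..2*k}) = f s" by (rule matrix_polynomials_cong) simp
    with s that show ?thesis by simp
  qed
  ultimately show ?thesis by blast
qed

text \<open>
  The denominators of \<open>f\<close> form an ideal without common zeros on the Stokes data, so 1 is among them.
\<close>

lemma locally_rational_imp_polynomial:
  assumes Q: "closed_values Q"
    and loc: "\<And>S. S \<in> stokes_points k Q \<Longrightarrow> \<exists>F\<in>matrix_polynomials (2*k).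
      \<exists>G\<in>matrix_polynomials (2*k). G S \<noteq> 0 \<and> (\<forall>S'\<in>stokes_points k Q. G S' * f S' = F S')"
  shows "\<exists>F\<in>matrix_polynomials (2*k). \<forall>S\<in>stokes_points k Q. f S = F S"
proof -
  let ?P = "matrix_polynomials (2*k)" and ?Y = "stokes_points k Q"
  define J where "J = {G \<in> ?P. \<exists>F\<in>?P. \<forall>S\<in>?Y. G S * f S = F S}"
  have JI: "G \<in> J" if "G \<in> ?P" "F \<in> ?P" "\<And>S. S \<in> ?Y \<Longrightarrow> G S * f S = F S" for F G
    using that by (auto simp: J_def)
  have id: "function_ideal (matrix_entries (2*k)) J"
  proof (rule function_idealI)
    show "(\<lambda>_. 0) \<in> J"
      by (rule JI[of _ "\<lambda>_. 0"]) (simp_all add: polynomials_in.const)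
    fix G assume "G \<in> J"
    then obtain F where GF: "G \<in> ?P" "F \<in> ?P" "\<And>S. S \<in> ?Y \<Longrightarrow> G S * f S = F S"
      by (auto simp: J_def)
    then show "G \<in> ?P" by simp
    show "(\<lambda>S. h S * G S) \<in> J" if "h \<in> ?P" for h
      by (rule JI[of _ "\<lambda>S. h S * F S"])
        (use GF that in \<open>auto intro: polynomials_in.mult simp: mult.assoc\<close>)
    fix G' assume "G' \<in> J"
    then obtain F' where GF': "G' \<in> ?P" "F' \<in> ?P" "\<And>S. S \<in> ?Y \<Longrightarrow> G' S * f S = F' S"
      by (auto simp: J_def)
    show "(\<lambda>S. G S + G' S) \<in> J"
      by (rule JI[of _ "\<lambda>S. F S + F' S"])
        (use GF GF' in \<open>auto intro: polynomials_in.add simp: distrib_right\<close>)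
  qed
  have "(\<lambda>_. 1) \<in> J"
  proof (rule ccontr)
    assume 1: "(\<lambda>_. 1) \<notin> J"
    have "g \<in> J" if "g \<in> ?P" "\<forall>S\<in>?Y. g S = 0" for g
      by (rule JI[of _ "\<lambda>_. 0"]) (use that in \<open>simp_all add: polynomials_in.const\<close>)
    from nullstellensatz_stokes_points[OF Q id 1 this]
    obtain S where S: "S \<in> ?Y" "\<forall>g\<in>J. g S = 0" by blast
    from loc[OF S(1)] obtain F G where "F \<in> ?P" "G \<in> ?P" "G S \<noteq> 0"
      "\<forall>S'\<in>?Y. G S' * f S' = F S'" by blast
    then have "G \<in> J" "G S \<noteq> 0" by (auto simp: J_def)
    with S(2) show False by blast
  qed
  then show ?thesis by (auto simp: J_def)
qed

section \<open>Weights of the torus\<close>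

lemma poly_eq_if_eq_nonzero:
  fixes p q :: "complex poly"
  assumes "\<And>x. x \<noteq> 0 \<Longrightarrow> poly p x = poly q x"
  shows "p = q"
proof (rule ccontr)
  assume "p \<noteq> q"
  then have "finite {x. poly (p - q) x = 0}" by (intro poly_roots_finite) simp
  moreover have "UNIV - {0} \<subseteq> {x. poly (p - q) x = 0}" using assms by auto
  ultimately have "finite (UNIV - {0 :: complex})" by (rule rev_finite_subset)
  then show False by (simp add: infinite_UNIV_char_0)
qed

text \<open>
  The Reynolds operator of the torus: \<open>f (twist n \<kappa> S)\<close> is a Laurent polynomial in \<open>\<kappa>\<close>, and this is its
  constant coefficient. The factor \<open>\<kappa> ^ N\<close> clears the negative powers; the value does not depend on the
  choice of \<open>N\<close>.
\<close>

definition weight_zero_part ::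
  "nat \<Rightarrow> ((nat \<Rightarrow> complex^2^2) \<Rightarrow> complex) \<Rightarrow> (nat \<Rightarrow> complex^2^2) \<Rightarrow> complex" where
  "weight_zero_part n f S = (THE c. \<exists>N p.
     (\<forall>\<kappa>. \<kappa> \<noteq> 0 \<longrightarrow> \<kappa> ^ N * f (twist n \<kappa> S) = poly p \<kappa>) \<and> c = coeff p N)"

lemma weight_zero_part_eq:
  assumes "\<And>\<kappa>. \<kappa> \<noteq> 0 \<Longrightarrow> \<kappa> ^ N * f (twist n \<kappa> S) = poly p \<kappa>"
  shows "weight_zero_part n f S = coeff p N"
  unfolding weight_zero_part_def
proof (rule the_equality)
  show "\<exists>N' p'. (\<forall>\<kappa>. \<kappa> \<noteq> 0 \<longrightarrow> \<kappa> ^ N' * f (twist n \<kappa> S) = poly p' \<kappa>) \<and> coeff p N = coeff p' N'"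
    using assms by blast
  fix c assume "\<exists>M r. (\<forall>\<kappa>. \<kappa> \<noteq> 0 \<longrightarrow> \<kappa> ^ M * f (twist n \<kappa> S) = poly r \<kappa>) \<and> c = coeff r M"
  then obtain M r where r: "\<And>\<kappa>. \<kappa> \<noteq> 0 \<Longrightarrow> \<kappa> ^ M * f (twist n \<kappa> S) = poly r \<kappa>" "c = coeff r M"
    by blast
  have "monom 1 N * r = monom 1 M * p"
    by (rule poly_eq_if_eq_nonzero)
      (simp add: poly_monom r(1)[symmetric] assms[symmetric] algebra_simps)
  then have "coeff (monom 1 N * r) (N + M) = coeff (monom 1 M * p) (N + M)" by simp
  then show "c = coeff p N" by (simp add: coeff_monom_mult r(2))
qed

text \<open>
  The entries have weight 1, 0 or -1 under the twist, which is the degree \<open>m\<close>, shifted by 1, of the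
  monomial in the case of a generator.
\<close>

lemma twist_expansion:
  assumes "f \<in> matrix_polynomials n"
  shows "\<exists>N p. (\<forall>S \<kappa>. \<kappa> \<noteq> 0 \<longrightarrow> \<kappa> ^ N * f (twist n \<kappa> S) = poly (p S) \<kappa>) \<and>
    (\<forall>j. (\<lambda>S. coeff (p S) j) \<in> matrix_polynomials n)"
  using assms
proof induction
  case (const c)
  have "(\<lambda>S. coeff [:c:] j) \<in> matrix_polynomials n" for j by (rule polynomials_in.const)
  then show ?case by (intro exI[of _ 0] exI[of _ "\<lambda>_. [:c:]"]) auto
next
  case (gen g)
  then obtain i a b where i: "i \<in> {1..n}" and g: "g = (\<lambda>S. S i $ a $ b)"
    by (auto simp: matrix_entries_def)
  define m :: nat where "m = (if a = b then 1 else if a = 1 then 2 else 0)"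
  have p: "\<kappa> ^ 1 * g (twist n \<kappa> S) = poly (monom (S i $ a $ b) m) \<kappa>" if "\<kappa> \<noteq> 0" for S \<kappa>
    using exhaust_2[of a] exhaust_2[of b] that
    by (auto simp: g m_def twist_nth[OF i] poly_monom power2_eq_square)
  have c: "(\<lambda>S. coeff (monom (S i $ a $ b) m) j) \<in> matrix_polynomials n" for j
    using matrix_entry_polynomial[OF i] polynomials_in.const[of 0] by (cases "m = j") simp_all
  show ?case
    by (intro exI[of _ 1] exI[of _ "\<lambda>S. monom (S i $ a $ b) m"] conjI allI impI p c)
next
  case (add f g)
  then obtain N p M r where
    f: "\<And>S \<kappa>. \<kappa> \<noteq> 0 \<Longrightarrow> \<kappa> ^ N * f (twist n \<kappa> S) = poly (p S) \<kappa>"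
      "\<And>j. (\<lambda>S. coeff (p S) j) \<in> matrix_polynomials n" and
    g: "\<And>S \<kappa>. \<kappa> \<noteq> 0 \<Longrightarrow> \<kappa> ^ M * g (twist n \<kappa> S) = poly (r S) \<kappa>"
      "\<And>j. (\<lambda>S. coeff (r S) j) \<in> matrix_polynomials n" by blast
  let ?s = "\<lambda>S. monom 1 M * p S + monom 1 N * r S"
  have pow: "\<kappa> ^ (N + M) * (f (twist n \<kappa> S) + g (twist n \<kappa> S)) = poly (?s S) \<kappa>" if "\<kappa> \<noteq> 0" for S \<kappa>
    by (simp add: poly_monom f(1)[OF that, symmetric] g(1)[OF that, symmetric] power_add
        algebra_simps)
  have coeff: "(\<lambda>S. coeff (?s S) j) \<in> matrix_polynomials n" for j
    unfolding coeff_add coeff_monom_mult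
    by (cases "M \<le> j"; cases "N \<le> j")
      (simp_all add: polynomials_in.add[OF f(2) g(2)] f(2) g(2) polynomials_in.const)
  show ?case
    by (intro exI[of _ "N + M"] exI[of _ "?s"] conjI allI impI pow coeff)
next
  case (mult f g)
  then obtain N p M r where
    f: "\<And>S \<kappa>. \<kappa> \<noteq> 0 \<Longrightarrow> \<kappa> ^ N * f (twist n \<kappa> S) = poly (p S) \<kappa>"
      "\<And>j. (\<lambda>S. coeff (p S) j) \<in> matrix_polynomials n" and
    g: "\<And>S \<kappa>. \<kappa> \<noteq> 0 \<Longrightarrow> \<kappa> ^ M * g (twist n \<kappa> S) = poly (r S) \<kappa>"
      "\<And>j. (\<lambda>S. coeff (r S) j) \<in> matrix_polynomials n" by blast
  have pow: "\<kappa> ^ (N + M) * (f (twist n \<kappa> S) * g (twist n \<kappa> S)) = poly (p S * r S) \<kappa>"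
    if "\<kappa> \<noteq> 0" for S \<kappa>
    by (simp add: f(1)[OF that, symmetric] g(1)[OF that, symmetric] power_add)
  have coeff: "(\<lambda>S. coeff (p S * r S) j) \<in> matrix_polynomials n" for j
    unfolding coeff_mult by (intro polynomials_in_sum polynomials_in.mult f(2) g(2))
  show ?case
    by (intro exI[of _ "N + M"] exI[of _ "\<lambda>S. p S * r S"] conjI allI impI pow coeff)
qed

lemma weight_zero_part_polynomial:
  assumes "f \<in> matrix_polynomials n"
  shows "weight_zero_part n f \<in> matrix_polynomials n"
proof -
  obtain N p where p: "\<And>S \<kappa>. \<kappa> \<noteq> 0 \<Longrightarrow> \<kappa> ^ N * f (twist n \<kappa> S) = poly (p S) \<kappa>"
    "\<And>j. (\<lambda>S. coeff (p S) j) \<in> matrix_polynomials n" using twist_expansion[OF assms] by blast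
  have "weight_zero_part n f = (\<lambda>S. coeff (p S) N)"
    by (rule ext) (rule weight_zero_part_eq[OF p(1)])
  with p(2) show ?thesis by simp
qed

lemma weight_zero_part_add:
  assumes f: "f \<in> matrix_polynomials n" and g: "g \<in> matrix_polynomials n"
  shows "weight_zero_part n (\<lambda>S. f S + g S) S = weight_zero_part n f S + weight_zero_part n g S"
proof -
  obtain N p where p: "\<And>S \<kappa>. \<kappa> \<noteq> 0 \<Longrightarrow> \<kappa> ^ N * f (twist n \<kappa> S) = poly (p S) \<kappa>"
    using twist_expansion[OF f] by blast
  obtain M r where r: "\<And>S \<kappa>. \<kappa> \<noteq> 0 \<Longrightarrow> \<kappa> ^ M * g (twist n \<kappa> S) = poly (r S) \<kappa>"
    using twist_expansion[OF g] by blast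
  have "weight_zero_part n (\<lambda>S. f S + g S) S = coeff (monom 1 M * p S + monom 1 N * r S) (N + M)"
    by (rule weight_zero_part_eq)
      (simp add: poly_monom p[symmetric] r[symmetric] power_add algebra_simps)
  then show ?thesis
    by (simp add: coeff_monom_mult weight_zero_part_eq[OF p] weight_zero_part_eq[OF r])
qed

lemma weight_zero_part_twist:
  assumes f: "f \<in> matrix_polynomials n" and m: "\<mu> \<noteq> 0"
  shows "weight_zero_part n f (twist n \<mu> S) = weight_zero_part n f S"
proof -
  obtain N p where p: "\<And>S \<kappa>. \<kappa> \<noteq> 0 \<Longrightarrow> \<kappa> ^ N * f (twist n \<kappa> S) = poly (p S) \<kappa>"
    using twist_expansion[OF f] by blast
  have "smult (\<mu> ^ N) (p (twist n \<mu> S)) = pcompose (p S) [:0, \<mu>:]"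
  proof (rule poly_eq_if_eq_nonzero)
    fix \<kappa> :: complex assume "\<kappa> \<noteq> 0"
    with m show "poly (smult (\<mu> ^ N) (p (twist n \<mu> S))) \<kappa> = poly (pcompose (p S) [:0, \<mu>:]) \<kappa>"
      by (simp add: poly_pcompose p[symmetric] twist_twist power_mult_distrib)
  qed
  then have "coeff (smult (\<mu> ^ N) (p (twist n \<mu> S))) N = coeff (pcompose (p S) [:0, \<mu>:]) N"
    by simp
  then have "coeff (p (twist n \<mu> S)) N = coeff (p S) N"
    using m by (simp add: coeff_pcompose_linear)
  then show ?thesis by (simp add: weight_zero_part_eq[OF p])
qed

text \<open>
  Linearity over the invariants: \<open>c\<close> is the value of an invariant factor along the orbit of \<open>S\<close>. The
  hypothesis refers to the orbit only, so that the lemma also applies to functions which agree with a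
  product merely on the Stokes data.
\<close>

lemma weight_zero_part_mult_invariant:
  assumes f: "f \<in> matrix_polynomials n"
    and g: "\<And>\<kappa>. \<kappa> \<noteq> 0 \<Longrightarrow> g (twist n \<kappa> S) = c * f (twist n \<kappa> S)"
  shows "weight_zero_part n g S = c * weight_zero_part n f S"
proof -
  obtain N p where p: "\<And>S \<kappa>. \<kappa> \<noteq> 0 \<Longrightarrow> \<kappa> ^ N * f (twist n \<kappa> S) = poly (p S) \<kappa>"
    using twist_expansion[OF f] by blast
  have "weight_zero_part n g S = coeff (smult c (p S)) N"
    by (rule weight_zero_part_eq) (simp add: g p[symmetric])
  then show ?thesis by (simp add: weight_zero_part_eq[OF p])
qed

lemma weight_zero_part_const: "weight_zero_part n (\<lambda>_. c) S = c"
  using weight_zero_part_eq[of 0 "\<lambda>_. c" n S "[:c:]"] by simp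

section \<open>Invariants of the Stokes data and their characters\<close>

definition stokes_invariants :: "nat \<Rightarrow> complex set \<Rightarrow> ((nat \<Rightarrow> complex^2^2) \<Rightarrow> complex) set" where
  "stokes_invariants k Q =
     invariants (torus_action (2*k)) (matrix_variety (2*k) (stokes_points k Q))"

lemma stokes_invariants_eq:
  "stokes_invariants k Q = {b. (\<exists>f\<in>matrix_polynomials (2*k). b = restrict f (stokes_points k Q)) \<and>
     (\<forall>\<kappa>. \<kappa> \<noteq> 0 \<longrightarrow> (\<forall>S\<in>stokes_points k Q. b (twist (2*k) \<kappa> S) = b S))}"
  unfolding stokes_invariants_def invariants_def matrix_variety_def torus_action_eq
    matrix_entries_def by auto

lemma stokes_invariantsI:
  assumes "f \<in> matrix_polynomials (2*k)"
    and "\<And>\<kappa> S. \<kappa> \<noteq> 0 \<Longrightarrow> S \<in> stokes_points k Q \<Longrightarrow> f (twist (2*k) \<kappa> S) = f S"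
  shows "restrict f (stokes_points k Q) \<in> stokes_invariants k Q"
  using assms twist_in_stokes_points by (auto simp: stokes_invariants_eq)

lemma stokes_invariantsE:
  assumes "b \<in> stokes_invariants k Q"
  obtains f where "f \<in> matrix_polynomials (2*k)" "b = restrict f (stokes_points k Q)"
    "\<And>\<kappa> S. \<kappa> \<noteq> 0 \<Longrightarrow> S \<in> stokes_points k Q \<Longrightarrow> f (twist (2*k) \<kappa> S) = f S"
proof -
  from assms obtain f where f: "f \<in> matrix_polynomials (2*k)" "b = restrict f (stokes_points k Q)"
    "\<And>\<kappa> S. \<kappa> \<noteq> 0 \<Longrightarrow> S \<in> stokes_points k Q \<Longrightarrow> b (twist (2*k) \<kappa> S) = b S"
    unfolding stokes_invariants_eq by blast
  show thesis
  proof (rule that[OF f(1,2)])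
    fix \<kappa> :: complex and S assume "\<kappa> \<noteq> 0" "S \<in> stokes_points k Q"
    with f(3)[of \<kappa> S] twist_in_stokes_points[of \<kappa> S k Q] show "f (twist (2*k) \<kappa> S) = f S"
      by (simp add: f(2))
  qed
qed

lemma stokes_invariants_twist:
  assumes "b \<in> stokes_invariants k Q" "\<kappa> \<noteq> 0" "S \<in> stokes_points k Q"
  shows "b (twist (2*k) \<kappa> S) = b S"
  using assms unfolding stokes_invariants_eq by blast

lemma stokes_invariants_const: "(\<lambda>S\<in>stokes_points k Q. c) \<in> stokes_invariants k Q"
  by (rule stokes_invariantsI) (simp_all add: polynomials_in.const)

lemma stokes_invariants_add:
  assumes "b \<in> stokes_invariants k Q" "b' \<in> stokes_invariants k Q"
  shows "(\<lambda>S\<in>stokes_points k Q. b S + b' S) \<in> stokes_invariants k Q"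
proof -
  from assms(1) obtain f where f: "f \<in> matrix_polynomials (2*k)" "b = restrict f (stokes_points k Q)"
    "\<And>\<kappa> S. \<kappa> \<noteq> 0 \<Longrightarrow> S \<in> stokes_points k Q \<Longrightarrow> f (twist (2*k) \<kappa> S) = f S"
    by (rule stokes_invariantsE) blast
  from assms(2) obtain g where g: "g \<in> matrix_polynomials (2*k)" "b' = restrict g (stokes_points k Q)"
    "\<And>\<kappa> S. \<kappa> \<noteq> 0 \<Longrightarrow> S \<in> stokes_points k Q \<Longrightarrow> g (twist (2*k) \<kappa> S) = g S"
    by (rule stokes_invariantsE) blast
  have "(\<lambda>S\<in>stokes_points k Q. b S + b' S) = (\<lambda>S\<in>stokes_points k Q. f S + g S)"
    by (rule restrict_ext) (simp add: f(2) g(2))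
  with stokes_invariantsI[OF polynomials_in.add[OF f(1) g(1)], of Q] f(3) g(3) show ?thesis by simp
qed

lemma stokes_invariants_mult:
  assumes "b \<in> stokes_invariants k Q" "b' \<in> stokes_invariants k Q"
  shows "(\<lambda>S\<in>stokes_points k Q. b S * b' S) \<in> stokes_invariants k Q"
proof -
  from assms(1) obtain f where f: "f \<in> matrix_polynomials (2*k)" "b = restrict f (stokes_points k Q)"
    "\<And>\<kappa> S. \<kappa> \<noteq> 0 \<Longrightarrow> S \<in> stokes_points k Q \<Longrightarrow> f (twist (2*k) \<kappa> S) = f S"
    by (rule stokes_invariantsE) blast
  from assms(2) obtain g where g: "g \<in> matrix_polynomials (2*k)" "b' = restrict g (stokes_points k Q)"
    "\<And>\<kappa> S. \<kappa> \<noteq> 0 \<Longrightarrow> S \<in> stokes_points k Q \<Longrightarrow> g (twist (2*k) \<kappa> S) = g S"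
    by (rule stokes_invariantsE) blast
  have "(\<lambda>S\<in>stokes_points k Q. b S * b' S) = (\<lambda>S\<in>stokes_points k Q. f S * g S)"
    by (rule restrict_ext) (simp add: f(2) g(2))
  with stokes_invariantsI[OF polynomials_in.mult[OF f(1) g(1)], of Q] f(3) g(3) show ?thesis by simp
qed

lemma stokes_invariants_restrict:
  assumes "b \<in> stokes_invariants k UNIV"
  shows "restrict b (stokes_points k Q) \<in> stokes_invariants k Q"
proof -
  have sub: "stokes_points k Q \<subseteq> stokes_points k UNIV" by (rule stokes_points_mono) simp
  from assms obtain f where f: "f \<in> matrix_polynomials (2*k)" "b = restrict f (stokes_points k UNIV)"
    "\<And>\<kappa> S. \<kappa> \<noteq> 0 \<Longrightarrow> S \<in> stokes_points k UNIV \<Longrightarrow> f (twist (2*k) \<kappa> S) = f S"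
    by (rule stokes_invariantsE) blast
  have "restrict b (stokes_points k Q) = restrict f (stokes_points k Q)"
    by (rule restrict_ext) (use sub f(2) in auto)
  with stokes_invariantsI[OF f(1), of Q] f(3) sub show ?thesis by auto
qed

lemma charactersD:
  assumes "\<xi> \<in> characters X A"
  shows "\<xi> \<in> extensional A" "\<xi> (\<lambda>x\<in>X. c) = c"
    "f \<in> A \<Longrightarrow> g \<in> A \<Longrightarrow> \<xi> (\<lambda>x\<in>X. f x + g x) = \<xi> f + \<xi> g"
    "f \<in> A \<Longrightarrow> g \<in> A \<Longrightarrow> \<xi> (\<lambda>x\<in>X. f x * g x) = \<xi> f * \<xi> g"
  using assms by (auto simp: characters_def)

text \<open>
  Every point of the quotient is the image of a point. Let \<open>J\<close> consist of the polynomials \<open>g\<close> such that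
  \<open>\<eta>\<close> kills the weight zero part of every multiple of \<open>g\<close>. This is an ideal, it contains the kernel of
  \<open>\<eta>\<close> because the weight zero part is linear over the invariants, and it does not contain 1. At a
  common zero of \<open>J\<close>, an invariant \<open>b\<close> takes the value \<open>\<eta> b\<close>, since \<open>b - \<eta> b\<close> is in the kernel.
\<close>

lemma character_is_evaluation:
  assumes Q: "closed_values Q"
    and \<eta>: "\<eta> \<in> characters (stokes_points k Q) (stokes_invariants k Q)"
  shows "\<exists>S\<in>stokes_points k Q. \<forall>b\<in>stokes_invariants k Q. \<eta> b = b S"
proof -
  let ?P = "matrix_polynomials (2*k)" and ?Y = "stokes_points k Q" and ?B = "stokes_invariants k Q"
  note \<eta>D = charactersD[OF \<eta>]
  define R where "R f = restrict (weight_zero_part (2*k) f) ?Y" for f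
  have R_in: "R f \<in> ?B" if "f \<in> ?P" for f
    unfolding R_def
    by (rule stokes_invariantsI[OF weight_zero_part_polynomial[OF that] weight_zero_part_twist[OF that]])
  have R_add: "R (\<lambda>S. f S + g S) = (\<lambda>S\<in>?Y. R f S + R g S)" if "f \<in> ?P" "g \<in> ?P" for f g
    unfolding R_def by (rule restrict_ext) (simp add: weight_zero_part_add[OF that])
  have R_mult: "R (\<lambda>S. f S * b S) = (\<lambda>S\<in>?Y. restrict b ?Y S * R f S)"
    if "f \<in> ?P" "restrict b ?Y \<in> ?B" for f b
    unfolding R_def
  proof (rule restrict_ext)
    fix S assume S: "S \<in> ?Y"
    have "b (twist (2*k) \<kappa> S) = b S" if "\<kappa> \<noteq> 0" for \<kappa>
      using stokes_invariants_twist[OF \<open>restrict b ?Y \<in> ?B\<close> that S]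
        twist_in_stokes_points[OF that S] S by simp
    then have "weight_zero_part (2*k) (\<lambda>S. f S * b S) S = b S * weight_zero_part (2*k) f S"
      by (intro weight_zero_part_mult_invariant[OF \<open>f \<in> ?P\<close>]) simp
    with S show "weight_zero_part (2*k) (\<lambda>S. f S * b S) S =
        restrict b ?Y S * restrict (weight_zero_part (2*k) f) ?Y S" by simp
  qed
  define J where "J = {g \<in> ?P. \<forall>f\<in>?P. \<eta> (R (\<lambda>S. f S * g S)) = 0}"
  \<comment> \<open>The part of \<open>J\<close> that comes from the kernel of \<open>\<eta>\<close>, and the functions vanishing on the points.\<close>
  have ker: "b \<in> J" if "b \<in> ?P" "restrict b ?Y \<in> ?B" "\<eta> (restrict b ?Y) = 0" for b
  proof -
    have "\<eta> (R (\<lambda>S. f S * b S)) = 0" if f: "f \<in> ?P" for f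
    proof -
      have "\<eta> (R (\<lambda>S. f S * b S)) = \<eta> (restrict b ?Y) * \<eta> (R f)"
        unfolding R_mult[OF f \<open>restrict b ?Y \<in> ?B\<close>] by (rule \<eta>D(4)[OF \<open>restrict b ?Y \<in> ?B\<close> R_in[OF f]])
      then show ?thesis using \<open>\<eta> (restrict b ?Y) = 0\<close> by simp
    qed
    with that(1) show ?thesis by (simp add: J_def)
  qed
  have vanish: "b \<in> J" if "b \<in> ?P" "\<forall>S\<in>?Y. b S = 0" for b
  proof (rule ker[OF that(1)])
    have "restrict b ?Y = (\<lambda>S\<in>?Y. 0)" by (rule restrict_ext) (use that in simp)
    then show "restrict b ?Y \<in> ?B" "\<eta> (restrict b ?Y) = 0"
      using stokes_invariants_const \<eta>D(2) by simp_all
  qed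
  have id: "function_ideal (matrix_entries (2*k)) J"
  proof (rule function_idealI)
    show "(\<lambda>_. 0) \<in> J" by (rule vanish) (simp_all add: polynomials_in.const)
    fix g assume g: "g \<in> J"
    then show "g \<in> ?P" by (simp add: J_def)
    show "(\<lambda>S. h S * g S) \<in> J" if h: "h \<in> ?P" for h
    proof -
      have "\<eta> (R (\<lambda>S. f S * (h S * g S))) = 0" if "f \<in> ?P" for f
      proof -
        have "\<eta> (R (\<lambda>S. (f S * h S) * g S)) = 0"
          using g polynomials_in.mult[OF that h] by (simp add: J_def)
        then show ?thesis by (simp add: mult.assoc)
      qed
      with g h show ?thesis by (simp add: J_def polynomials_in.mult)
    qed
    fix g' assume g': "g' \<in> J"
    have "\<eta> (R (\<lambda>S. f S * (g S + g' S))) = 0" if f: "f \<in> ?P" for f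
    proof -
      have fg: "(\<lambda>S. f S * g S) \<in> ?P" "(\<lambda>S. f S * g' S) \<in> ?P"
        using g g' f by (auto simp: J_def intro: polynomials_in.mult)
      have "\<eta> (R (\<lambda>S. f S * g S + f S * g' S)) = \<eta> (R (\<lambda>S. f S * g S)) + \<eta> (R (\<lambda>S. f S * g' S))"
        unfolding R_add[OF fg] by (rule \<eta>D(3)[OF R_in[OF fg(1)] R_in[OF fg(2)]])
      with g g' f show ?thesis by (simp add: J_def distrib_left)
    qed
    with g g' show "(\<lambda>S. g S + g' S) \<in> J" by (simp add: J_def polynomials_in.add)
  qed
  have "(\<lambda>_. 1) \<notin> J"
  proof
    assume "(\<lambda>_. 1) \<in> J"
    then have "\<forall>f\<in>?P. \<eta> (R (\<lambda>S. f S * 1)) = 0" by (simp add: J_def)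
    from bspec[OF this polynomials_in.const[of 1]] have "\<eta> (R (\<lambda>S. 1 * 1)) = 0" .
    moreover have "R (\<lambda>S. 1 * 1) = (\<lambda>S\<in>?Y. 1)"
      unfolding R_def by (rule restrict_ext) (simp add: weight_zero_part_const)
    ultimately show False using \<eta>D(2)[of 1] by simp
  qed
  from nullstellensatz_stokes_points[OF Q id this vanish]
  obtain S where S: "S \<in> ?Y" "\<forall>g\<in>J. g S = 0" by blast
  have "\<eta> b = b S" if b: "b \<in> ?B" for b
  proof -
    from b obtain f where f: "f \<in> ?P" "b = restrict f ?Y"
      by (rule stokes_invariantsE) blast
    let ?g = "\<lambda>S. f S + (- \<eta> b)"
    have r: "restrict ?g ?Y = (\<lambda>S\<in>?Y. b S + (\<lambda>S\<in>?Y. - \<eta> b) S)"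
      by (rule restrict_ext) (simp add: f(2))
    have "?g \<in> J"
    proof (rule ker)
      show "?g \<in> ?P" by (rule polynomials_in.add[OF f(1) polynomials_in.const])
      show "restrict ?g ?Y \<in> ?B"
        unfolding r by (rule stokes_invariants_add[OF b stokes_invariants_const])
      have "\<eta> (\<lambda>S\<in>?Y. b S + (\<lambda>S\<in>?Y. - \<eta> b) S) = \<eta> b + \<eta> (\<lambda>S\<in>?Y. - \<eta> b)"
        by (rule \<eta>D(3)[OF b stokes_invariants_const])
      then show "\<eta> (restrict ?g ?Y) = 0" unfolding r by (simp add: \<eta>D(2))
    qed
    from bspec[OF S(2) this] have "f S + (- \<eta> b) = 0" .
    with S(1) f(2) show ?thesis by simp
  qed
  with S(1) show ?thesis by blast
qed

section \<open>Multihomogeneous forms and regularity\<close>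

lemma multi_forms_homogeneous:
  "F \<in> multi_forms n d \<Longrightarrow> F (\<lambda>i. c i *s v i) = (\<Prod>i=1..n. c i ^ d i) * F v"
  by (simp add: multi_forms_def)

lemma multi_forms_const: "(\<lambda>_. c) \<in> multi_forms n (\<lambda>_. 0)"
  by (simp add: multi_forms_def polynomials_in.const)

lemma multi_forms_add:
  "F \<in> multi_forms n d \<Longrightarrow> G \<in> multi_forms n d \<Longrightarrow> (\<lambda>v. F v + G v) \<in> multi_forms n d"
  unfolding multi_forms_def by (simp add: polynomials_in.add distrib_left)

lemma multi_forms_mult:
  "F \<in> multi_forms n d \<Longrightarrow> G \<in> multi_forms n e \<Longrightarrow> (\<lambda>v. F v * G v) \<in> multi_forms n (\<lambda>i. d i + e i)"
  unfolding multi_forms_def by (simp add: polynomials_in.mult power_add prod.distrib)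

lemma multi_forms_cmult:
  "F \<in> multi_forms n d \<Longrightarrow> (\<lambda>v. c * F v) \<in> multi_forms n d"
  using multi_forms_mult[OF multi_forms_const] by simp

definition unit_degree :: "nat \<Rightarrow> nat \<Rightarrow> nat" where
  "unit_degree i j = (if j = i then 1 else 0)"

lemma prod_power_unit_degree:
  "i \<in> {1..n} \<Longrightarrow> (\<Prod>j=1..n. c j ^ unit_degree i j) = (c i :: complex)"
  by (subst prod.remove[of _ i]) (auto simp: unit_degree_def intro!: prod.neutral)

lemma multi_forms_coordinate:
  assumes i: "i \<in> {1..n}"
  shows "(\<lambda>v. v i $ a) \<in> multi_forms n (unit_degree i)"
proof -
  have "(\<lambda>v. v i $ a) \<in> polynomials_in {(\<lambda>v. v i $ j) | i j. i \<in> {1..n}}"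
    by (rule polynomials_in.gen) (use i in blast)
  then show ?thesis unfolding multi_forms_def by (simp only: prod_power_unit_degree[OF i]) simp
qed

lemma multi_forms_vec_det:
  assumes "i \<in> {1..n}" "j \<in> {1..n}"
  shows "(\<lambda>v. vec_det (v i) (v j)) \<in> multi_forms n (\<lambda>l. unit_degree i l + unit_degree j l)"
proof -
  have m: "(\<lambda>v. v i $ a * v j $ b) \<in> multi_forms n (\<lambda>l. unit_degree i l + unit_degree j l)" for a b
    by (intro multi_forms_mult multi_forms_coordinate assms)
  from multi_forms_add[OF m[of 1 2] multi_forms_cmult[OF m[of 2 1], of "-1"]]
  show ?thesis by (simp add: vec_det_eq)
qed

text \<open>
  Quotients of forms of equal multidegree whose denominators have no zeros on \<open>U\<close>. Unlike forms, they
  can be added and multiplied freely, which makes any polynomial in such functions one of them.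
\<close>

definition form_ratio ::
  "nat \<Rightarrow> (nat \<Rightarrow> complex^2) set \<Rightarrow> ((nat \<Rightarrow> complex^2) \<Rightarrow> complex) \<Rightarrow> bool" where
  "form_ratio n U \<phi> \<longleftrightarrow> (\<exists>d. \<exists>F\<in>multi_forms n d. \<exists>G\<in>multi_forms n d.
     \<forall>v\<in>U. G v \<noteq> 0 \<and> \<phi> v = F v / G v)"

lemma form_ratioI:
  "F \<in> multi_forms n d \<Longrightarrow> G \<in> multi_forms n d \<Longrightarrow>
    (\<And>v. v \<in> U \<Longrightarrow> G v \<noteq> 0) \<Longrightarrow> (\<And>v. v \<in> U \<Longrightarrow> \<phi> v = F v / G v) \<Longrightarrow> form_ratio n U \<phi>"
  unfolding form_ratio_def by blast

lemma form_ratio_const: "form_ratio n U (\<lambda>_. c)"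
  by (rule form_ratioI[OF multi_forms_const[of c] multi_forms_const[of 1]]) auto

lemma form_ratio_add:
  assumes "form_ratio n U \<phi>" "form_ratio n U \<psi>"
  shows "form_ratio n U (\<lambda>v. \<phi> v + \<psi> v)"
proof -
  from assms obtain d F G e F' G' where
    f: "F \<in> multi_forms n d" "G \<in> multi_forms n d" "\<forall>v\<in>U. G v \<noteq> 0 \<and> \<phi> v = F v / G v" and
    g: "F' \<in> multi_forms n e" "G' \<in> multi_forms n e" "\<forall>v\<in>U. G' v \<noteq> 0 \<and> \<psi> v = F' v / G' v"
    unfolding form_ratio_def by blast
  have "(\<lambda>v. G v * F' v) \<in> multi_forms n (\<lambda>i. d i + e i)"
    by (rule multi_forms_mult[OF f(2) g(1)])
  from multi_forms_add[OF multi_forms_mult[OF f(1) g(2)] this] multi_forms_mult[OF f(2) g(2)]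
  show ?thesis by (rule form_ratioI) (use f(3) g(3) in \<open>auto simp: field_simps\<close>)
qed

lemma form_ratio_mult:
  assumes "form_ratio n U \<phi>" "form_ratio n U \<psi>"
  shows "form_ratio n U (\<lambda>v. \<phi> v * \<psi> v)"
proof -
  from assms obtain d F G e F' G' where
    f: "F \<in> multi_forms n d" "G \<in> multi_forms n d" "\<forall>v\<in>U. G v \<noteq> 0 \<and> \<phi> v = F v / G v" and
    g: "F' \<in> multi_forms n e" "G' \<in> multi_forms n e" "\<forall>v\<in>U. G' v \<noteq> 0 \<and> \<psi> v = F' v / G' v"
    unfolding form_ratio_def by blast
  from multi_forms_mult[OF f(1) g(1)] multi_forms_mult[OF f(2) g(2)]
  show ?thesis by (rule form_ratioI) (use f(3) g(3) in auto)
qed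

lemma form_ratio_polynomial:
  assumes "f \<in> polynomials_in B" "\<And>b. b \<in> B \<Longrightarrow> form_ratio n U (\<lambda>v. b (T v))"
  shows "form_ratio n U (\<lambda>v. f (T v))"
  using assms(1)
  by induction (auto intro: form_ratio_const form_ratio_add form_ratio_mult assms(2))

text \<open>
  The tuples of vectors that can be scaled to a normalized frame, with the scale fixed by a coordinate
  of the \<open>n\<close>-th vector.
\<close>

definition chart :: "nat \<Rightarrow> 2 \<Rightarrow> (nat \<Rightarrow> complex^2) set" where
  "chart n a = {v. v n $ a \<noteq> 0 \<and>
     (\<forall>i\<le>n. vec_det (v (cyclic_index n i)) (v (cyclic_index n (Suc i))) \<noteq> 0)}"

lemma cyclic_index_in: "n \<ge> 1 \<Longrightarrow> i \<le> Suc n \<Longrightarrow> cyclic_index n i \<in> {1..n}"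
  by (auto simp: cyclic_index_def)

text \<open>
  With the first factor chosen as the inverse of a coordinate, the \<open>i\<close>-th factor is homogeneous of
  degree \<open>-1\<close> in the \<open>i\<close>-th vector and of degree 0 in all others. So the vectors of the frame, and with
  them the entries of its Stokes data, have degree 0.
\<close>

lemma frame_scale_form_ratio:
  assumes n: "n \<ge> 1" and "i \<le> Suc n"
  shows "\<exists>d. \<exists>F\<in>multi_forms n d. \<exists>G\<in>multi_forms n (\<lambda>l. d l + unit_degree (cyclic_index n i) l).
    \<forall>v\<in>chart n a. F v \<noteq> 0 \<and> G v \<noteq> 0 \<and>
      frame_scale (\<lambda>i. v (cyclic_index n i)) (1 / v n $ a) i = F v / G v"
  using assms(2)
proof (induction i)
  case 0
  have "(\<lambda>v. v n $ a) \<in> multi_forms n (\<lambda>l. 0 + unit_degree (cyclic_index n 0) l)"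
    using multi_forms_coordinate[of n n a] n by (simp add: cyclic_index_def)
  then show ?case
    by (intro exI[of _ "\<lambda>_. 0"] bexI[OF _ multi_forms_const[of 1]] bexI[of _ "\<lambda>v. v n $ a"])
      (auto simp: chart_def)
next
  case (Suc i)
  let ?c = "cyclic_index n" and ?u = unit_degree
  from Suc obtain d F G where F: "F \<in> multi_forms n d" and G: "G \<in> multi_forms n (\<lambda>l. d l + ?u (?c i) l)"
    and FG: "\<forall>v\<in>chart n a. F v \<noteq> 0 \<and> G v \<noteq> 0 \<and>
      frame_scale (\<lambda>i. v (?c i)) (1 / v n $ a) i = F v / G v" by auto
  have num: "(\<lambda>v. (- 1) ^ Suc i * G v) \<in> multi_forms n (\<lambda>l. d l + ?u (?c i) l)"
    by (rule multi_forms_cmult[OF G])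
  have den: "(\<lambda>v. F v * vec_det (v (?c i)) (v (?c (Suc i)))) \<in>
      multi_forms n (\<lambda>l. (d l + ?u (?c i) l) + ?u (?c (Suc i)) l)"
    using multi_forms_mult[OF F multi_forms_vec_det[of "?c i" n "?c (Suc i)"]]
      cyclic_index_in[OF n] Suc.prems by (simp add: add.assoc)
  have quot: "\<forall>v\<in>chart n a. (- 1) ^ Suc i * G v \<noteq> 0 \<and>
      F v * vec_det (v (?c i)) (v (?c (Suc i))) \<noteq> 0 \<and>
      frame_scale (\<lambda>i. v (?c i)) (1 / v n $ a) (Suc i) =
        ((- 1) ^ Suc i * G v) / (F v * vec_det (v (?c i)) (v (?c (Suc i))))"
    using FG Suc.prems by (auto simp: chart_def)
  show ?case by (rule exI, rule bexI[OF _ num], rule bexI[OF _ den], rule quot)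
qed

lemma stokes_of_form_ratio:
  assumes n: "n \<ge> 1" and i: "i \<in> {1..n}"
  shows "form_ratio n (chart n a) (\<lambda>v. stokes_of n
    (\<lambda>i. frame_scale (\<lambda>i. v (cyclic_index n i)) (1 / v n $ a) i *s v (cyclic_index n i)) i $ r $ s)"
proof -
  let ?c = "cyclic_index n" and ?u = unit_degree
  let ?f = "\<lambda>v. frame_scale (\<lambda>i. v (?c i)) (1 / v n $ a)"
  have i': "i - 1 \<le> Suc n" "Suc i \<le> Suc n" using i by auto
  obtain d F G where F: "F \<in> multi_forms n d" and G: "G \<in> multi_forms n (\<lambda>l. d l + ?u (?c (i - 1)) l)"
    and FG: "\<forall>v\<in>chart n a. F v \<noteq> 0 \<and> G v \<noteq> 0 \<and> ?f v (i - 1) = F v / G v"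
    using frame_scale_form_ratio[OF n i'(1)] by blast
  obtain e F' G' where F': "F' \<in> multi_forms n e" and G': "G' \<in> multi_forms n (\<lambda>l. e l + ?u (?c (Suc i)) l)"
    and FG': "\<forall>v\<in>chart n a. F' v \<noteq> 0 \<and> G' v \<noteq> 0 \<and> ?f v (Suc i) = F' v / G' v"
    using frame_scale_form_ratio[OF n i'(2)] by blast
  let ?D = "\<lambda>v :: nat \<Rightarrow> complex^2. vec_det (v (?c (i - 1))) (v (?c (Suc i)))"
  let ?d = "\<lambda>l. (d l + ?u (?c (i - 1)) l) + (e l + ?u (?c (Suc i)) l)"
  have deg: "(\<lambda>l. (d l + e l) + (?u (?c (i - 1)) l + ?u (?c (Suc i)) l)) = ?d"
    by (rule ext) simp
  have "(\<lambda>v. (- 1) ^ Suc i * (F v * F' v * ?D v)) \<in> multi_forms n ?d"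
    unfolding deg[symmetric]
    by (intro multi_forms_cmult multi_forms_mult multi_forms_vec_det F F' cyclic_index_in n i')
  moreover have "(\<lambda>v. G v * G' v) \<in> multi_forms n ?d" by (rule multi_forms_mult[OF G G'])
  ultimately have "form_ratio n (chart n a)
      (\<lambda>v. (- 1) ^ Suc i * vec_det (?f v (i - 1) *s v (?c (i - 1))) (?f v (Suc i) *s v (?c (Suc i))))"
    by (rule form_ratioI) (use FG FG' in \<open>auto simp: vec_det_scale\<close>)
  note entry = this
  have "stokes_of n (\<lambda>i. ?f v i *s v (?c i)) i $ r $ s =
      (if r = s then 1 else if odd i \<longleftrightarrow> r = 1
        then (- 1) ^ Suc i * vec_det (?f v (i - 1) *s v (?c (i - 1))) (?f v (Suc i) *s v (?c (Suc i)))
        else 0)" for v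
    using i exhaust_2[of r] exhaust_2[of s] by (elim disjE) (simp_all add: stokes_of_def unipotent_def)
  then show ?thesis
    using entry form_ratio_const by (cases "r = s"; cases "odd i \<longleftrightarrow> r = 1") simp_all
qed

text \<open>
  Regularity is local, so near a given point the frame may be scaled by a coordinate of the last vector
  that does not vanish there. Different scalings change the Stokes data by the torus only, which an
  invariant does not notice.
\<close>

lemma regular_of_stokes_invariant:
  assumes k: "k \<ge> 1" and b: "b \<in> stokes_invariants k Q"
  shows "(\<lambda>p\<in>sibuya_points k Q. b (stokes_of_lines k p)) \<in>
    regular_functions (2*k) (sibuya_points k Q)"
  unfolding regular_functions_def
proof (intro CollectI conjI ballI)
  fix p assume p: "p \<in> sibuya_points k Q"
  let ?n = "2*k" and ?Y = "sibuya_points k Q"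
  have n: "?n \<ge> 1" "?n \<in> {1..?n}" using k by auto
  from b obtain f where f: "f \<in> matrix_polynomials ?n" "b = restrict f (stokes_points k Q)"
    by (rule stokes_invariantsE) blast
  obtain v where v: "spans ?n v p"
    using sibuya_points_frame_ex[OF k p] normalized_frame_spans by blast
  have "v ?n \<noteq> 0" using v n(2) by (simp add: spans_def)
  then obtain a where a: "v ?n $ a \<noteq> 0" by (auto simp: vec_eq_iff)
  let ?T = "\<lambda>v. stokes_of ?n
    (\<lambda>i. frame_scale (\<lambda>i. v (cyclic_index ?n i)) (1 / v ?n $ a) i *s v (cyclic_index ?n i))"
  have "form_ratio ?n (chart ?n a) (\<lambda>v. f (?T v))"
    by (rule form_ratio_polynomial[OF f(1)])
      (auto simp: matrix_entries_def intro!: stokes_of_form_ratio[OF n(1)])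
  then obtain d F G where FG: "F \<in> multi_forms ?n d" "G \<in> multi_forms ?n d"
    "\<forall>v\<in>chart ?n a. G v \<noteq> 0 \<and> f (?T v) = F v / G v"
    unfolding form_ratio_def by blast
  have chart: "v' \<in> chart ?n a" if "p' \<in> ?Y" "spans ?n v' p'" "v' ?n $ a \<noteq> 0" for p' v'
    using sibuya_space_vec_det[OF k _ that(2)] that by (auto simp: chart_def sibuya_points_def)
  have val: "b (stokes_of_lines k p') = F v' / G v'"
    if "p' \<in> ?Y" "spans ?n v' p'" "v' ?n $ a \<noteq> 0" for p' v'
  proof -
    have p': "p' \<in> sibuya_space k" using that by (simp add: sibuya_points_def)
    have fr: "normalized_frame ?n p' (\<lambda>i. frame_scale (\<lambda>i. v' (cyclic_index ?n i)) (1 / v' ?n $ a) i *s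
        v' (cyclic_index ?n i))"
      by (rule normalized_frame_exists[OF k p' that(2)]) (use that(3) in simp)
    have "b (stokes_of_lines k p') = b (?T v')"
      by (rule twist_invariant_stokes_of[OF stokes_invariants_twist[OF b] k that(1) fr])
    also have "\<dots> = f (?T v')"
      using normalized_frame_stokes_of[OF k fr] that(1)
      by (auto simp: f(2) stokes_points_def sibuya_points_def)
    also have "\<dots> = F v' / G v'" using FG(3) chart[OF that] by blast
    finally show ?thesis .
  qed
  note coord = multi_forms_coordinate[OF n(2), of a]
  show "\<exists>d. \<exists>F\<in>multi_forms ?n d. \<exists>G\<in>multi_forms ?n d.
    (\<exists>v. spans ?n v p \<and> G v \<noteq> 0) \<and>
    (\<forall>p'\<in>?Y. \<forall>v. spans ?n v p' \<longrightarrow> G v \<noteq> 0 \<longrightarrow>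
       (\<lambda>p\<in>?Y. b (stokes_of_lines k p)) p' = F v / G v)"
    by (rule exI, rule bexI[OF _ multi_forms_mult[OF FG(1) coord]],
        rule bexI[OF _ multi_forms_mult[OF FG(2) coord]])
      (use v a FG(3) chart[OF p v a] val in auto)
qed simp

text \<open>
  The vectors of Stokes data are polynomial in its entries, so a local quotient of forms becomes a local
  quotient of polynomials. For \<open>f S' * G S' = F S'\<close> to hold also at the zeros of \<open>G\<close>, numerator and
  denominator are multiplied by \<open>G\<close>.
\<close>

lemma regular_pullback_polynomial:
  assumes k: "k \<ge> 1" and Q: "closed_values Q"
    and f: "f \<in> regular_functions (2*k) (sibuya_points k Q)"
  shows "\<exists>F\<in>matrix_polynomials (2*k). \<forall>S\<in>stokes_points k Q. f (stokes_lines k S) = F S"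
proof (rule locally_rational_imp_polynomial[OF Q])
  fix S assume S: "S \<in> stokes_points k Q"
  let ?n = "2*k" and ?Y = "sibuya_points k Q"
  have spans: "spans ?n (stokes_vector S') (stokes_lines k S')" if "S' \<in> stokes_points k Q" for S'
    by (rule normalized_frame_spans, rule normalized_frame_stokes_lines[OF k])
      (use that in \<open>simp add: stokes_points_def\<close>)
  note mem = stokes_lines_in_sibuya_points[OF k]
  obtain d F G v where F: "F \<in> multi_forms ?n d" and G: "G \<in> multi_forms ?n d"
    and v: "spans ?n v (stokes_lines k S)" "G v \<noteq> 0"
    and FG: "\<And>p v. p \<in> ?Y \<Longrightarrow> spans ?n v p \<Longrightarrow> G v \<noteq> 0 \<Longrightarrow> f p = F v / G v"
    using f mem[OF S] unfolding regular_functions_def by blast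
  have poly: "(\<lambda>S. H (stokes_vector S)) \<in> matrix_polynomials ?n" if "H \<in> multi_forms ?n d" for H
    by (rule polynomials_in_comp[of H "{(\<lambda>v. v i $ j) | i j. i \<in> {1..?n}}"])
      (use that in \<open>auto simp: multi_forms_def intro!: stokes_vector_polynomial\<close>)
  have "G (stokes_vector S) \<noteq> 0"
  proof -
    have "\<exists>c. c \<noteq> 0 \<and> stokes_vector S i = c *s v i" if "i \<in> {1..?n}" for i
    proof -
      have "stokes_lines k S i = vec.span {v i}" using v(1) that by (simp add: spans_def)
      moreover have "stokes_lines k S i = vec.span {stokes_vector S i}" "stokes_vector S i \<noteq> 0"
        using spans[OF S] that by (simp_all add: spans_def)
      ultimately show ?thesis using span_eqD[of "stokes_vector S i" "v i"] by metis
    qed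
    then obtain c where c: "\<And>i. i \<in> {1..?n} \<Longrightarrow> c i \<noteq> 0 \<and> stokes_vector S i = c i *s v i"
      by metis
    have "G (stokes_vector S) = G (\<lambda>i. c i *s v i)"
      by (rule polynomials_in_cong[of G "{(\<lambda>v. v i $ j) | i j. i \<in> {1..?n}}"])
        (use G c in \<open>auto simp: multi_forms_def\<close>)
    also have "\<dots> = (\<Prod>i=1..?n. c i ^ d i) * G v" by (rule multi_forms_homogeneous[OF G])
    finally show ?thesis using c v(2) by simp
  qed
  then show "\<exists>F\<in>matrix_polynomials ?n. \<exists>G\<in>matrix_polynomials ?n. G S \<noteq> 0 \<and>
      (\<forall>S'\<in>stokes_points k Q. G S' * f (stokes_lines k S') = F S')"
    by (intro bexI[OF _ polynomials_in.mult[OF poly[OF F] poly[OF G]]]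
        bexI[OF _ polynomials_in.mult[OF poly[OF G] poly[OF G]]])
      (use FG[OF mem spans] in \<open>auto simp: field_simps\<close>)
qed

section \<open>Isomorphism of the quotients\<close>

text \<open>
  Maps \<open>\<sigma>\<close> and \<open>\<tau>\<close> that are mutually inverse as far as the functions in \<open>A\<close> and \<open>B\<close> can tell identify
  the two algebras, and hence the affine varieties with these coordinate rings. They need not be inverse
  to each other on the points; here they are so up to group actions. That \<open>A\<close> is closed under the
  operations follows from the same property of \<open>B\<close>.
\<close>

lemma variety_iso_affine_variety_of:
  fixes \<sigma> :: "'y \<Rightarrow> 'x" and \<tau> :: "'x \<Rightarrow> 'y"
  assumes \<sigma>: "\<And>y. y \<in> Y \<Longrightarrow> \<sigma> y \<in> X" and \<tau>: "\<And>x. x \<in> X \<Longrightarrow> \<tau> x \<in> Y"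
    and pull: "\<And>f. f \<in> A \<Longrightarrow> (\<lambda>y\<in>Y. f (\<sigma> y)) \<in> B" "\<And>b. b \<in> B \<Longrightarrow> (\<lambda>x\<in>X. b (\<tau> x)) \<in> A"
    and inverse: "\<And>f x. f \<in> A \<Longrightarrow> x \<in> X \<Longrightarrow> f (\<sigma> (\<tau> x)) = f x"
      "\<And>b y. b \<in> B \<Longrightarrow> y \<in> Y \<Longrightarrow> b (\<tau> (\<sigma> y)) = b y"
    and A: "A \<subseteq> extensional X" and B: "B \<subseteq> extensional Y"
    and const: "\<And>c. (\<lambda>y\<in>Y. c) \<in> B"
    and add: "\<And>b b'. b \<in> B \<Longrightarrow> b' \<in> B \<Longrightarrow> (\<lambda>y\<in>Y. b y + b' y) \<in> B"
    and mult: "\<And>b b'. b \<in> B \<Longrightarrow> b' \<in> B \<Longrightarrow> (\<lambda>y\<in>Y. b y * b' y) \<in> B"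
  shows "variety_iso (affine_variety_of X A) (affine_variety_of Y B)
    (\<lambda>\<xi>. \<lambda>b\<in>B. \<xi> (\<lambda>x\<in>X. b (\<tau> x)))"
proof -
  define push where "push f = (\<lambda>y\<in>Y. f (\<sigma> y))" for f :: "'x \<Rightarrow> complex"
  define lift where "lift b = (\<lambda>x\<in>X. b (\<tau> x))" for b :: "'y \<Rightarrow> complex"
  have pp: "lift (push f) = f" if "f \<in> A" for f
  proof
    fix x show "lift (push f) x = f x"
      using that A \<tau> inverse(1)[OF that] by (cases "x \<in> X") (auto simp: lift_def push_def extensional_def)
  qed
  have pp': "push (lift b) = b" if "b \<in> B" for b
  proof
    fix y show "push (lift b) y = b y"
      using that B \<sigma> inverse(2)[OF that] by (cases "y \<in> Y") (auto simp: lift_def push_def extensional_def)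
  qed
  have in_A: "lift b \<in> A" if "b \<in> B" for b using pull(2)[OF that] by (simp add: lift_def)
  have in_B: "push f \<in> B" if "f \<in> A" for f using pull(1)[OF that] by (simp add: push_def)
  have lift_const: "lift (\<lambda>y\<in>Y. c) = (\<lambda>x\<in>X. c)" for c
    unfolding lift_def by (rule restrict_ext) (simp add: \<tau>)
  have lift_add: "lift (\<lambda>y\<in>Y. b y + b' y) = (\<lambda>x\<in>X. lift b x + lift b' x)" for b b'
    unfolding lift_def by (rule restrict_ext) (simp add: \<tau>)
  have lift_mult: "lift (\<lambda>y\<in>Y. b y * b' y) = (\<lambda>x\<in>X. lift b x * lift b' x)" for b b'
    unfolding lift_def by (rule restrict_ext) (simp add: \<tau>)
  have push_const: "push (\<lambda>x\<in>X. c) = (\<lambda>y\<in>Y. c)" for c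
    unfolding push_def by (rule restrict_ext) (simp add: \<sigma>)
  have push_add: "push (\<lambda>x\<in>X. f x + g x) = (\<lambda>y\<in>Y. push f y + push g y)" for f g
    unfolding push_def by (rule restrict_ext) (simp add: \<sigma>)
  have push_mult: "push (\<lambda>x\<in>X. f x * g x) = (\<lambda>y\<in>Y. push f y * push g y)" for f g
    unfolding push_def by (rule restrict_ext) (simp add: \<sigma>)
  have A_const: "(\<lambda>x\<in>X. c) \<in> A" for c using in_A[OF const] by (simp add: lift_const)
  have A_add: "(\<lambda>x\<in>X. f x + g x) \<in> A" if "f \<in> A" "g \<in> A" for f g
    using in_A[OF add[OF in_B in_B]] that by (simp add: lift_add pp)
  have A_mult: "(\<lambda>x\<in>X. f x * g x) \<in> A" if "f \<in> A" "g \<in> A" for f g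
    using in_A[OF mult[OF in_B in_B]] that by (simp add: lift_mult pp)
  let ?\<Phi> = "\<lambda>\<xi>. \<lambda>b\<in>B. \<xi> (lift b)" and ?\<Psi> = "\<lambda>\<eta>. \<lambda>f\<in>A. \<eta> (push f)"
  have \<Phi>: "?\<Phi> \<xi> \<in> characters Y B" if "\<xi> \<in> characters X A" for \<xi>
    unfolding characters_def
    using charactersD(2-4)[OF that] in_A
    by (auto simp: const add mult lift_const lift_add lift_mult)
  have \<Psi>: "?\<Psi> \<eta> \<in> characters X A" if "\<eta> \<in> characters Y B" for \<eta>
    unfolding characters_def
    using charactersD(2-4)[OF that] in_B
    by (auto simp: A_const A_add A_mult push_const push_add push_mult)
  have \<Psi>\<Phi>: "?\<Psi> (?\<Phi> \<xi>) = \<xi>" if "\<xi> \<in> characters X A" for \<xi>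
  proof
    fix f show "?\<Psi> (?\<Phi> \<xi>) f = \<xi> f"
      using charactersD(1)[OF that] by (cases "f \<in> A") (auto simp: in_B pp extensional_def)
  qed
  have \<Phi>\<Psi>: "?\<Phi> (?\<Psi> \<eta>) = \<eta>" if "\<eta> \<in> characters Y B" for \<eta>
  proof
    fix b show "?\<Phi> (?\<Psi> \<eta>) b = \<eta> b"
      using charactersD(1)[OF that] by (cases "b \<in> B") (auto simp: in_A pp' extensional_def)
  qed
  have bij: "bij_betw ?\<Phi> (characters X A) (characters Y B)"
    by (rule bij_betw_byWitness[of _ ?\<Psi>]) (use \<Phi> \<Psi> \<Psi>\<Phi> \<Phi>\<Psi> in blast)+
  have reg: "g \<in> regular (affine_variety_of Y B) \<longleftrightarrow>
      (\<lambda>\<xi>\<in>characters X A. g (?\<Phi> \<xi>)) \<in> regular (affine_variety_of X A)"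
    if g: "g \<in> extensional (characters Y B)" for g
  proof
    assume "g \<in> regular (affine_variety_of Y B)"
    then obtain b where b: "b \<in> B" "g = (\<lambda>\<eta>\<in>characters Y B. \<eta> b)"
      by (auto simp: affine_variety_of_def)
    have "(\<lambda>\<xi>\<in>characters X A. g (?\<Phi> \<xi>)) = (\<lambda>\<xi>\<in>characters X A. \<xi> (lift b))"
      by (rule restrict_ext) (simp only: b(2) restrict_apply \<Phi> b(1) if_True)
    with in_A[OF b(1)] show "(\<lambda>\<xi>\<in>characters X A. g (?\<Phi> \<xi>)) \<in> regular (affine_variety_of X A)"
      by (auto simp: affine_variety_of_def)
  next
    assume "(\<lambda>\<xi>\<in>characters X A. g (?\<Phi> \<xi>)) \<in> regular (affine_variety_of X A)"
    then obtain f where f: "f \<in> A"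
      "(\<lambda>\<xi>\<in>characters X A. g (?\<Phi> \<xi>)) = (\<lambda>\<xi>\<in>characters X A. \<xi> f)"
      by (auto simp: affine_variety_of_def)
    have "g = (\<lambda>\<eta>\<in>characters Y B. \<eta> (push f))"
    proof
      fix \<eta>
      show "g \<eta> = (\<lambda>\<eta>\<in>characters Y B. \<eta> (push f)) \<eta>"
      proof (cases "\<eta> \<in> characters Y B")
        case True
        from fun_cong[OF f(2), of "?\<Psi> \<eta>"] have "g (?\<Phi> (?\<Psi> \<eta>)) = ?\<Psi> \<eta> f"
          by (simp only: restrict_apply \<Psi>[OF True] if_True)
        with \<Phi>\<Psi>[OF True] True f(1) show ?thesis by simp
      next
        case False
        with g show ?thesis by (simp add: extensional_def)
      qed
    qed
    with in_B[OF f(1)] show "g \<in> regular (affine_variety_of Y B)"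
      by (auto simp: affine_variety_of_def)
  qed
  show ?thesis
    using bij reg unfolding variety_iso_def lift_def by (simp add: affine_variety_of_def)
qed

definition sibuya_invariants :: "nat \<Rightarrow> complex set \<Rightarrow> ((nat \<Rightarrow> (complex^2) set) \<Rightarrow> complex) set" where
  "sibuya_invariants k Q = invariants (psl2_action (2*k))
     \<lparr>points = sibuya_points k Q, regular = regular_functions (2*k) (sibuya_points k Q)\<rparr>"

lemma sibuya_invariants_eq:
  "sibuya_invariants k Q = {f \<in> regular_functions (2*k) (sibuya_points k Q).
     \<forall>g\<in>psl2_action (2*k). \<forall>p\<in>sibuya_points k Q. f (g p) = f p}"
  by (simp add: sibuya_invariants_def invariants_def)

lemma sibuya_points_extensional: "p \<in> sibuya_points k Q \<Longrightarrow> p \<in> extensional {1..2*k}"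
  by (auto simp: sibuya_points_def sibuya_space_def PiE_def)

text \<open>
  The lines of \<open>S\<close> have a second frame whose Stokes data is \<open>twist (2*k) \<kappa> S\<close>, obtained by rescaling with
  a square root of \<open>\<kappa>\<close>. So the lines of \<open>S\<close> and of its twist lie in one orbit.
\<close>

lemma stokes_lines_of_invariant:
  assumes k: "k \<ge> 1" and Q: "closed_values Q" and f: "f \<in> sibuya_invariants k Q"
  shows "(\<lambda>S\<in>stokes_points k Q. f (stokes_lines k S)) \<in> stokes_invariants k Q"
proof -
  from f have f: "f \<in> regular_functions (2*k) (sibuya_points k Q)"
    "\<And>g p. g \<in> psl2_action (2*k) \<Longrightarrow> p \<in> sibuya_points k Q \<Longrightarrow> f (g p) = f p"
    by (auto simp: sibuya_invariants_eq)
  obtain F where F: "F \<in> matrix_polynomials (2*k)"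
    "\<And>S. S \<in> stokes_points k Q \<Longrightarrow> f (stokes_lines k S) = F S"
    using regular_pullback_polynomial[OF k Q f(1)] by blast
  have "F (twist (2*k) \<kappa> S) = F S" if \<kappa>: "\<kappa> \<noteq> 0" and S: "S \<in> stokes_points k Q" for \<kappa> S
  proof -
    have S': "S \<in> stokes_points k UNIV" "S \<in> stokes_data k" using S by (auto simp: stokes_points_def)
    have mem: "stokes_lines k S \<in> sibuya_points k Q" "stokes_lines k (twist (2*k) \<kappa> S) \<in> sibuya_points k Q"
      using S \<kappa> by (auto intro!: stokes_lines_in_sibuya_points[OF k] twist_in_stokes_points)
    note fr = normalized_frame_rescale[OF normalized_frame_stokes_lines[OF k S'(1)], of "csqrt \<kappa>"]
    from fr \<kappa> obtain u where u: "normalized_frame (2*k) (stokes_lines k S) u"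
      "stokes_of (2*k) u = twist (2*k) \<kappa> S"
      by (auto simp: stokes_of_stokes_vector[OF S'(2)])
    obtain g where "g \<in> psl2_action (2*k)" "stokes_lines k S = g (stokes_lines k (twist (2*k) \<kappa> S))"
      using normalized_frame_orbit[OF sibuya_points_extensional[OF mem(1)] u(1)] u(2) by auto
    with f(2) mem have "f (stokes_lines k S) = f (stokes_lines k (twist (2*k) \<kappa> S))" by simp
    with F(2) S twist_in_stokes_points[OF \<kappa> S] show ?thesis by simp
  qed
  with stokes_invariantsI[OF F(1)] have "restrict F (stokes_points k Q) \<in> stokes_invariants k Q"
    by blast
  moreover have "(\<lambda>S\<in>stokes_points k Q. f (stokes_lines k S)) = restrict F (stokes_points k Q)"
    by (rule restrict_ext) (rule F(2))
  ultimately show ?thesis by simp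
qed

lemma stokes_of_lines_invariant:
  assumes k: "k \<ge> 1" and b: "b \<in> stokes_invariants k Q"
  shows "(\<lambda>p\<in>sibuya_points k Q. b (stokes_of_lines k p)) \<in> sibuya_invariants k Q"
  unfolding sibuya_invariants_eq
proof (intro CollectI conjI ballI)
  have tw: "b (stokes_of_lines k p) = b (stokes_of (2*k) u)"
    if "p \<in> sibuya_points k Q" "normalized_frame (2*k) p u" for p u
    by (rule twist_invariant_stokes_of[OF stokes_invariants_twist[OF b] k that])
  fix g p assume g: "g \<in> psl2_action (2*k)" and p: "p \<in> sibuya_points k Q"
  obtain u where u: "normalized_frame (2*k) p u" using sibuya_points_frame_ex[OF k p] by blast
  obtain u' where u': "normalized_frame (2*k) (g p) u'" "stokes_of (2*k) u' = stokes_of (2*k) u"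
    "g p \<in> sibuya_points k Q" by (rule psl2_action_frame[OF k p g u])
  have "b (stokes_of_lines k (g p)) = b (stokes_of_lines k p)"
    by (simp only: tw[OF p u] tw[OF u'(3,1)] u'(2))
  with p u'(3) show "(\<lambda>p\<in>sibuya_points k Q. b (stokes_of_lines k p)) (g p) =
      (\<lambda>p\<in>sibuya_points k Q. b (stokes_of_lines k p)) p" by simp
qed (rule regular_of_stokes_invariant[OF k b])

lemma sibuya_wild_variety_iso:
  assumes k: "k \<ge> 1" and Q: "closed_values Q"
  shows "variety_iso (affine_variety_of (sibuya_points k Q) (sibuya_invariants k Q))
    (affine_variety_of (stokes_points k Q) (stokes_invariants k Q))
    (\<lambda>\<xi>. \<lambda>b\<in>stokes_invariants k Q. \<xi> (\<lambda>p\<in>sibuya_points k Q. b (stokes_of_lines k p)))"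
proof (rule variety_iso_affine_variety_of[where \<sigma> = "stokes_lines k"])
  show "sibuya_invariants k Q \<subseteq> extensional (sibuya_points k Q)"
    by (auto simp: sibuya_invariants_eq regular_functions_def)
  show "stokes_invariants k Q \<subseteq> extensional (stokes_points k Q)"
    by (auto simp: stokes_invariants_eq)
next
  fix f p assume f: "f \<in> sibuya_invariants k Q" and p: "p \<in> sibuya_points k Q"
  obtain u where u: "normalized_frame (2*k) p u" "stokes_of_lines k p = stokes_of (2*k) u"
    by (rule stokes_of_lines_frame[OF k p])
  obtain g where g: "g \<in> psl2_action (2*k)" "p = g (stokes_lines k (stokes_of_lines k p))"
    using normalized_frame_orbit[OF sibuya_points_extensional[OF p] u(1)] u(2) by auto
  have "f (g (stokes_lines k (stokes_of_lines k p))) = f (stokes_lines k (stokes_of_lines k p))"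
    using f g(1) stokes_lines_in_sibuya_points[OF k stokes_of_lines_in_stokes_points[OF k p]]
    by (auto simp: sibuya_invariants_eq)
  with g(2) show "f (stokes_lines k (stokes_of_lines k p)) = f p" by simp
next
  fix b S assume b: "b \<in> stokes_invariants k Q" and S: "S \<in> stokes_points k Q"
  then have S': "S \<in> stokes_points k UNIV" "S \<in> stokes_data k" by (auto simp: stokes_points_def)
  show "b (stokes_of_lines k (stokes_lines k S)) = b S"
    using twist_invariant_stokes_of[OF stokes_invariants_twist[OF b] k
        stokes_lines_in_sibuya_points[OF k S] normalized_frame_stokes_lines[OF k S'(1)]]
    by (simp add: stokes_of_stokes_vector[OF S'(2)])
qed (blast intro: stokes_lines_in_sibuya_points[OF k] stokes_of_lines_in_stokes_points[OF k]
    stokes_lines_of_invariant[OF k Q] stokes_of_lines_invariant[OF k] stokes_invariants_const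
    stokes_invariants_add stokes_invariants_mult)+

lemma sibuya_moduli_eq:
  "sibuya_moduli k = affine_variety_of (sibuya_points k UNIV) (sibuya_invariants k UNIV)"
  by (simp add: sibuya_moduli_def git_quotient_def sibuya_variety_def sibuya_invariants_def
      sibuya_points_def)

lemma sibuya_moduli_level_eq:
  "sibuya_moduli_level k q = affine_variety_of (sibuya_points k {q}) (sibuya_invariants k {q})"
  by (simp add: sibuya_moduli_level_def git_quotient_def sibuya_level_def sibuya_invariants_def
      sibuya_points_def Let_def)

lemma wild_char_variety_eq:
  "wild_char_variety k = affine_variety_of (stokes_points k UNIV) (stokes_invariants k UNIV)"
  by (simp add: wild_char_variety_def git_quotient_def wild_variety_def stokes_invariants_def
      stokes_points_def matrix_variety_def)

text \<open>
  The product has determinant 1, so if it is diagonal, its lower right entry determines it.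
\<close>

lemma wild_fibre_points_eq:
  assumes "q \<noteq> 0"
  shows "{S \<in> stokes_data k. stokes_product S (2*k) = diag2 (inverse q) q} = stokes_points k {q}"
proof -
  have "stokes_product S (2*k) = diag2 (inverse q) q \<longleftrightarrow>
      stokes_product S (2*k) \<in> torus \<and> stokes_product S (2*k) $ 2 $ 2 = q"
    if "S \<in> stokes_data k" for S
  proof -
    have "det (stokes_product S (2*k)) = 1" by (rule det_stokes_product[OF that order_refl])
    then show ?thesis
      using assms by (auto simp: torus_def invertible_det_nz det_2 diag2_def vec2_eq_iff field_simps)
  qed
  then show ?thesis by (auto simp: stokes_points_def)
qed

lemma wild_char_leaf_eq:
  assumes "q \<noteq> 0"
  shows "wild_char_leaf k (diag2 (inverse q) q) =
    affine_variety_of (stokes_points k {q}) (stokes_invariants k {q})"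
  by (simp add: wild_char_leaf_def git_quotient_def wild_fibre_def stokes_invariants_def
      wild_fibre_points_eq[OF assms] matrix_variety_def)

lemma wild_inclusion_eq:
  assumes "q \<noteq> 0"
  shows "wild_inclusion k (diag2 (inverse q) q) \<xi> =
    (\<lambda>b\<in>stokes_invariants k UNIV. \<xi> (restrict b (stokes_points k {q})))"
  by (simp add: wild_inclusion_def git_inclusion_def wild_fibre_def wild_variety_def
      stokes_invariants_def wild_fibre_points_eq[OF assms] matrix_variety_def stokes_points_def)

lemma sibuya_inclusion_eq:
  "sibuya_inclusion k q \<xi> =
    (\<lambda>f\<in>sibuya_invariants k UNIV. \<xi> (restrict f (sibuya_points k {q})))"
  by (simp add: sibuya_inclusion_def git_inclusion_def sibuya_level_def sibuya_variety_def
      sibuya_invariants_def sibuya_points_def Let_def)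

section \<open>Multi-ratio and symplectic leaves\<close>

text \<open>
  The invariant function on the Stokes data that corresponds to the multi-ratio.
\<close>

definition formal_monodromy :: "nat \<Rightarrow> (nat \<Rightarrow> complex^2^2) \<Rightarrow> complex" where
  "formal_monodromy k = (\<lambda>S\<in>stokes_points k UNIV. stokes_product S (2*k) $ 2 $ 2)"

lemma formal_monodromy_invariant: "formal_monodromy k \<in> stokes_invariants k UNIV"
  unfolding formal_monodromy_def
  by (rule stokes_invariantsI[OF stokes_product_polynomial[OF order_refl]])
    (simp add: stokes_product_twist)

lemma multi_ratio_eq_formal_monodromy:
  assumes k: "k \<ge> 1"
  shows "restrict (multi_ratio k) (sibuya_space k) =
    (\<lambda>p\<in>sibuya_points k UNIV. formal_monodromy k (stokes_of_lines k p))"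
proof -
  have "multi_ratio k p = formal_monodromy k (stokes_of_lines k p)" if "p \<in> sibuya_points k UNIV" for p
  proof -
    have "p \<in> sibuya_points k {multi_ratio k p}" using that by (simp add: sibuya_points_def)
    from stokes_of_lines_in_stokes_points[OF k this] show ?thesis
      by (simp add: formal_monodromy_def stokes_points_def)
  qed
  moreover have "sibuya_points k UNIV = sibuya_space k" by (simp add: sibuya_points_def)
  ultimately show ?thesis by (auto intro!: restrict_ext)
qed

lemma evaluation_character:
  assumes "S \<in> stokes_points k Q"
  shows "(\<lambda>b\<in>stokes_invariants k Q. b S) \<in> characters (stokes_points k Q) (stokes_invariants k Q)"
  using assms unfolding characters_def
  by (auto simp: stokes_invariants_const stokes_invariants_add stokes_invariants_mult)

lemma character_restrict:
  assumes \<xi>: "\<xi> \<in> characters (stokes_points k Q) (stokes_invariants k Q)"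
  shows "(\<lambda>b\<in>stokes_invariants k UNIV. \<xi> (restrict b (stokes_points k Q))) \<in>
    characters (stokes_points k UNIV) (stokes_invariants k UNIV)"
proof -
  let ?Y = "stokes_points k UNIV" and ?Y' = "stokes_points k Q"
  have sub: "?Y' \<subseteq> ?Y" by (rule stokes_points_mono) simp
  note \<xi>D = charactersD[OF \<xi>]
  have c: "restrict (\<lambda>S\<in>?Y. c) ?Y' = (\<lambda>S\<in>?Y'. c)" for c :: complex
    by (rule restrict_ext) (use sub in auto)
  have a: "restrict (\<lambda>S\<in>?Y. f S + g S) ?Y' = (\<lambda>S\<in>?Y'. restrict f ?Y' S + restrict g ?Y' S)"
    for f g :: "(nat \<Rightarrow> complex^2^2) \<Rightarrow> complex" by (rule restrict_ext) (use sub in auto)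
  have m: "restrict (\<lambda>S\<in>?Y. f S * g S) ?Y' = (\<lambda>S\<in>?Y'. restrict f ?Y' S * restrict g ?Y' S)"
    for f g :: "(nat \<Rightarrow> complex^2^2) \<Rightarrow> complex" by (rule restrict_ext) (use sub in auto)
  note r = stokes_invariants_restrict[of _ k Q]
  let ?B = "stokes_invariants k UNIV"
  let ?\<eta> = "\<lambda>b\<in>?B. \<xi> (restrict b ?Y')"
  have "?\<eta> (\<lambda>S\<in>?Y. c) = c" for c
    using c[of c] \<xi>D(2)[of c] by (simp only: restrict_apply stokes_invariants_const if_True)
  moreover have "?\<eta> (\<lambda>S\<in>?Y. f S + g S) = ?\<eta> f + ?\<eta> g" if fg: "f \<in> ?B" "g \<in> ?B" for f g
  proof -
    have "?\<eta> (\<lambda>S\<in>?Y. f S + g S) = \<xi> (restrict (\<lambda>S\<in>?Y. f S + g S) ?Y')"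
      by (rule restrict_apply') (rule stokes_invariants_add[OF fg])
    also have "\<dots> = \<xi> (restrict f ?Y') + \<xi> (restrict g ?Y')"
      unfolding a by (rule \<xi>D(3)[OF r[OF fg(1)] r[OF fg(2)]])
    finally show ?thesis using fg by simp
  qed
  moreover have "?\<eta> (\<lambda>S\<in>?Y. f S * g S) = ?\<eta> f * ?\<eta> g" if fg: "f \<in> ?B" "g \<in> ?B" for f g
  proof -
    have "?\<eta> (\<lambda>S\<in>?Y. f S * g S) = \<xi> (restrict (\<lambda>S\<in>?Y. f S * g S) ?Y')"
      by (rule restrict_apply') (rule stokes_invariants_mult[OF fg])
    also have "\<dots> = \<xi> (restrict f ?Y') * \<xi> (restrict g ?Y')"
      unfolding m by (rule \<xi>D(4)[OF r[OF fg(1)] r[OF fg(2)]])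
    finally show ?thesis using fg by simp
  qed
  ultimately show ?thesis unfolding characters_def by blast
qed

text \<open>
  A character that takes the value \<open>q\<close> at the formal monodromy is the evaluation at some Stokes data,
  which then lies in the fibre over \<open>q\<close>; evaluating there extends the character to the invariants of the
  fibre.
\<close>

lemma characters_of_leaf:
  "(\<lambda>\<xi>. \<lambda>b\<in>stokes_invariants k UNIV. \<xi> (restrict b (stokes_points k {q}))) `
      characters (stokes_points k {q}) (stokes_invariants k {q}) =
    {\<eta> \<in> characters (stokes_points k UNIV) (stokes_invariants k UNIV). \<eta> (formal_monodromy k) = q}"
  (is "?r ` ?C = ?D")
proof (intro equalityI subsetI)
  fix \<eta> assume "\<eta> \<in> ?r ` ?C"
  then obtain \<xi> where \<xi>: "\<xi> \<in> ?C" "\<eta> = ?r \<xi>" by blast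
  have "restrict (formal_monodromy k) (stokes_points k {q}) = (\<lambda>S\<in>stokes_points k {q}. q)"
    by (rule restrict_ext) (simp add: formal_monodromy_def stokes_points_def)
  then have "\<eta> (formal_monodromy k) = q"
    using charactersD(2)[OF \<xi>(1)] by (simp add: \<xi>(2) formal_monodromy_invariant)
  with character_restrict[OF \<xi>(1)] show "\<eta> \<in> ?D" by (simp add: \<xi>(2))
next
  fix \<eta> assume \<eta>: "\<eta> \<in> ?D"
  then obtain S where S: "S \<in> stokes_points k UNIV" "\<forall>b\<in>stokes_invariants k UNIV. \<eta> b = b S"
    using character_is_evaluation[of UNIV \<eta> k] by (auto simp: closed_values_def)
  have "formal_monodromy k S = q" using \<eta> S formal_monodromy_invariant by auto
  with S(1) have Sq: "S \<in> stokes_points k {q}" by (auto simp: formal_monodromy_def stokes_points_def)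
  let ?\<xi> = "\<lambda>b\<in>stokes_invariants k {q}. b S"
  have "\<eta> = ?r ?\<xi>"
  proof
    fix b
    show "\<eta> b = ?r ?\<xi> b"
    proof (cases "b \<in> stokes_invariants k UNIV")
      case True
      then show ?thesis using S(2) Sq stokes_invariants_restrict[OF True, of "{q}"] by simp
    next
      case False
      then show ?thesis using \<eta> charactersD(1)[of \<eta>] by (auto simp: extensional_def)
    qed
  qed
  with evaluation_character[OF Sq] show "\<eta> \<in> ?r ` ?C" by blast
qed

theorem proposition9:
  fixes k :: nat
  assumes "k \<ge> 1"
  shows "\<exists>\<Phi>. variety_iso (sibuya_moduli k) (wild_char_variety k) \<Phi> \<and>
    (\<forall>q::complex. q \<noteq> 0 \<longrightarrow>
      \<Phi> ` {x \<in> points (sibuya_moduli k). moduli_multi_ratio k x = q} =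
        wild_inclusion k (diag2 (inverse q) q) ` points (wild_char_leaf k (diag2 (inverse q) q)) \<and>
      (\<exists>\<Psi>. variety_iso (sibuya_moduli_level k q) (wild_char_leaf k (diag2 (inverse q) q)) \<Psi> \<and>
        (\<forall>x \<in> points (sibuya_moduli_level k q).
          \<Phi> (sibuya_inclusion k q x) = wild_inclusion k (diag2 (inverse q) q) (\<Psi> x))))"
proof -
  define \<Phi> where "\<Phi> Q \<xi> = (\<lambda>b\<in>stokes_invariants k Q.
    \<xi> (\<lambda>p\<in>sibuya_points k Q. b (stokes_of_lines k p)))"
    for Q and \<xi> :: "_ \<Rightarrow> complex"
  have iso: "variety_iso (affine_variety_of (sibuya_points k Q) (sibuya_invariants k Q))
      (affine_variety_of (stokes_points k Q) (stokes_invariants k Q)) (\<Phi> Q)"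
    if "closed_values Q" for Q
    using sibuya_wild_variety_iso[OF assms that] by (simp add: \<Phi>_def[abs_def])
  have bij: "bij_betw (\<Phi> UNIV) (points (sibuya_moduli k)) (points (wild_char_variety k))"
    using iso[of UNIV] by (simp add: variety_iso_def sibuya_moduli_eq wild_char_variety_eq closed_values_def)
  have ratio: "moduli_multi_ratio k x = \<Phi> UNIV x (formal_monodromy k)" for x
    by (simp add: moduli_multi_ratio_def multi_ratio_eq_formal_monodromy[OF assms] \<Phi>_def
        formal_monodromy_invariant)
  have image: "\<Phi> UNIV ` {x \<in> points (sibuya_moduli k). moduli_multi_ratio k x = q} =
      {\<eta> \<in> points (wild_char_variety k). \<eta> (formal_monodromy k) = q}" for q
    unfolding ratio bij_betw_imp_surj_on[OF bij, symmetric] by auto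
  have compat: "\<Phi> UNIV (sibuya_inclusion k q x) = wild_inclusion k (diag2 (inverse q) q) (\<Phi> {q} x)"
    if "q \<noteq> 0" for q x
  proof -
    have sub: "sibuya_points k {q} \<subseteq> sibuya_points k UNIV" by (auto simp: sibuya_points_def)
    have "restrict (\<lambda>p\<in>sibuya_points k UNIV. b (stokes_of_lines k p)) (sibuya_points k {q}) =
        (\<lambda>p\<in>sibuya_points k {q}. restrict b (stokes_points k {q}) (stokes_of_lines k p))"
      for b :: "(nat \<Rightarrow> complex^2^2) \<Rightarrow> complex"
      by (rule restrict_ext) (use sub stokes_of_lines_in_stokes_points[OF assms] in auto)
    then show ?thesis
      unfolding wild_inclusion_eq[OF that] sibuya_inclusion_eq \<Phi>_def
      by (intro restrict_ext)
        (simp add: stokes_of_lines_invariant[OF assms] stokes_invariants_restrict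
          del: restrict_restrict)
  qed
  show ?thesis
  proof (rule exI[of _ "\<Phi> UNIV"], intro conjI allI impI)
    show "variety_iso (sibuya_moduli k) (wild_char_variety k) (\<Phi> UNIV)"
      using iso[of UNIV] by (simp add: sibuya_moduli_eq wild_char_variety_eq closed_values_def)
    fix q :: complex assume q: "q \<noteq> 0"
    show "\<Phi> UNIV ` {x \<in> points (sibuya_moduli k). moduli_multi_ratio k x = q} =
        wild_inclusion k (diag2 (inverse q) q) ` points (wild_char_leaf k (diag2 (inverse q) q))"
      unfolding image wild_char_leaf_eq[OF q] wild_char_variety_eq wild_inclusion_eq[OF q, abs_def]
      using characters_of_leaf[of k q] by (simp add: affine_variety_of_def)
    show "\<exists>\<Psi>. variety_iso (sibuya_moduli_level k q) (wild_char_leaf k (diag2 (inverse q) q)) \<Psi> \<and>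
        (\<forall>x \<in> points (sibuya_moduli_level k q).
          \<Phi> UNIV (sibuya_inclusion k q x) = wild_inclusion k (diag2 (inverse q) q) (\<Psi> x))"
      using iso[of "{q}"] compat[OF q] unfolding sibuya_moduli_level_eq wild_char_leaf_eq[OF q]
      by (intro exI[of _ "\<Phi> {q}"]) (simp add: closed_values_def)
  qed
qed

end
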